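(* Let $\alpha>0$, $\mathcal{X}=[0,\infty)$, and for $\theta>0$ let $p_\theta(x)=\frac1\theta\mathbf{1}_{[0,\theta]}(x)$. Let $\mu$ be any Radon sub-probability measure on $\mathcal{E}$ satisfying $\int_{\mathcal{E}}e_x(r)\,\mu(dr)=1$ for almost every $x\in\mathcal{X}$, and let $$\widetilde p_\theta(dr)=\left(\frac1\theta\int_0^\theta r(x)\,dx\right)\mu(dr),\qquad\theta>0,$$ be the law on $\mathcal{E}$ of the public data produced by the mechanism $q^{(\mu)}_x(dr)=e_x(r)\mu(dr)$ when the private variable is uniform on $[0,\theta]$. Then for almost every $\theta_0\in(0,\infty)$ the model $(\widetilde p_\theta)_\theta$ is DQM at $\theta_0$, and the following upper bound on its Fisher information holds: $$\mathcal{I}_{\theta_0}\left((\widetilde p_\theta)_\theta\right)\le\frac{(e^\alpha-1)^2}{\theta_0^2}.$$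
   Context: "Almost every" refers to Lebesgue measure. Let $C=\{v:\mathcal{X}\to\mathbb{R}\text{ measurable}: 1\le v(x)\le e^\alpha\text{ a.e.}\}\subset L^\infty(\mathcal{X},\mathbb{R})$, equipped with the weak-$\star$ topology $\sigma(L^\infty,L^1)$ (compact metrizable) and its Borel $\sigma$-algebra, and $\mathcal{E}=\{r:\mathcal{X}\to\mathbb{R}\text{ measurable}: r(x)\in\{1,e^\alpha\}\text{ a.e.}\}\subset C$, the set of extreme points of $C$, a Borel subset. Functions are identified when equal a.e. Evaluation operator: $e_x(r)=\limsup_{\epsilon\to0}\frac{1}{|B(x,\epsilon)|}\int_{B(x,\epsilon)\cap\mathcal{X}}r(y)\,dy$; it is jointly measurable in $(x,r)$ and for each $r$, $e_x(r)=r(x)$ for a.e. $x$. DQM (differentiability in quadratic mean): a model with densities $f_\theta$ with respect to a measure $\mu$, with real parameter, is DQM at an interior point $\theta_0$ with measurable score $t_{\theta_0}$ if $\int\left(\sqrt{f_{\theta_0+h}}-\sqrt{f_{\theta_0}}-\tfrac12h\,t_{\theta_0}\sqrt{f_{\theta_0}}\right)^2d\mu=o(h^2)$ as $h\to0$; its Fisher information at $\theta_0$ is $\mathcal{I}_{\theta_0}=\int t_{\theta_0}^2f_{\theta_0}\,d\mu$. *)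

theory Defs
  imports "HOL-Probability.Probability" "HOL-Library.Landau_Symbols"
begin

definition linf_rel :: "(real \<Rightarrow> real) \<Rightarrow> (real \<Rightarrow> real) \<Rightarrow> bool" where
  "linf_rel f g \<longleftrightarrow>
     f \<in> borel_measurable (lebesgue_on {0..}) \<and> g \<in> borel_measurable (lebesgue_on {0..}) \<and>
     (\<exists>B. AE x in lebesgue_on {0..}. \<bar>f x\<bar> \<le> B) \<and>
     (AE x in lebesgue_on {0..}. f x = g x)"

text \<open>The space \<open>L\<^sup>\<infinity>([0,\<infinity>), \<real>)\<close>: classes, modulo equality almost everywhere on \<open>[0,\<infinity>)\<close>, of essentially
  bounded measurable functions. A representative is a function on all of \<open>\<real>\<close> whose values at
  negative arguments are irrelevant.\<close>

quotient_type linf = "real \<Rightarrow> real" / partial: linf_rel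
proof (rule part_equivpI)
  show "\<exists>f. linf_rel f f"
    by (rule exI[of _ "\<lambda>_. 0"]) (auto simp: linf_rel_def)
  have *: "\<exists>B. AE x in lebesgue_on {0..}. \<bar>g x\<bar> \<le> B" if fg: "linf_rel f g" for f g
  proof -
    obtain B where "AE x in lebesgue_on {0..}. \<bar>f x\<bar> \<le> B"
      using fg by (auto simp: linf_rel_def)
    moreover have "AE x in lebesgue_on {0..}. f x = g x"
      using fg by (auto simp: linf_rel_def)
    ultimately have "AE x in lebesgue_on {0..}. \<bar>g x\<bar> \<le> B"
      by eventually_elim simp
    then show ?thesis ..
  qed
  show "symp linf_rel"
  proof (rule sympI)
    fix f g assume fg: "linf_rel f g"
    have "AE x in lebesgue_on {0..}. f x = g x"
      using fg by (auto simp: linf_rel_def)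
    then have "AE x in lebesgue_on {0..}. g x = f x"
      by eventually_elim simp
    with fg *[OF fg] show "linf_rel g f"
      by (auto simp: linf_rel_def)
  qed
  show "transp linf_rel"
  proof (rule transpI)
    fix f g h assume fg: "linf_rel f g" and gh: "linf_rel g h"
    have "AE x in lebesgue_on {0..}. f x = g x" "AE x in lebesgue_on {0..}. g x = h x"
      using fg gh by (auto simp: linf_rel_def)
    then have "AE x in lebesgue_on {0..}. f x = h x"
      by eventually_elim simp
    with fg gh show "linf_rel f h"
      by (auto simp: linf_rel_def)
  qed
qed

lemma linf_rel_set_integral_cong:
  assumes "linf_rel f g" "A \<in> sets lebesgue" "A \<subseteq> {0..}"
  shows "(LINT y:A|lebesgue. f y) = (LINT y:A|lebesgue. g y)"
proof -
  have X: "{0::real..} \<in> sets lebesgue" by simp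
  have eq: "indicator A y *\<^sub>R h y = indicator A y *\<^sub>R (indicator {0..} y *\<^sub>R h y)"
    for y :: real and h :: "real \<Rightarrow> real"
    using assms(3) by (auto simp: indicator_def)
  have meas: "(\<lambda>y. indicator A y *\<^sub>R h y) \<in> borel_measurable lebesgue"
    if "h \<in> borel_measurable (lebesgue_on {0..})" for h :: "real \<Rightarrow> real"
  proof -
    have "(\<lambda>y. indicator {0..} y *\<^sub>R h y) \<in> borel_measurable lebesgue"
      using that X by (subst (asm) borel_measurable_restrict_space_iff) auto
    then have "(\<lambda>y. indicator A y *\<^sub>R (indicator {0..} y *\<^sub>R h y)) \<in> borel_measurable lebesgue"
      using assms(2) by (rule borel_measurable_scaleR[OF borel_measurable_indicator, rotated])
    moreover have "(\<lambda>y. indicator A y *\<^sub>R h y) =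
        (\<lambda>y. indicator A y *\<^sub>R (indicator {0..} y *\<^sub>R h y))"
      by (rule ext) (rule eq)
    ultimately show ?thesis by (simp only:)
  qed
  have "AE y in lebesgue. y \<in> {0..} \<longrightarrow> f y = g y"
    using assms(1) X by (simp add: linf_rel_def AE_restrict_space_iff)
  then have "AE y in lebesgue. indicator A y *\<^sub>R f y = indicator A y *\<^sub>R g y"
    by eventually_elim (use assms(3) in \<open>auto simp: indicator_def\<close>)
  then show ?thesis
    unfolding set_lebesgue_integral_def
    using assms(1) by (intro integral_cong_AE meas) (auto simp: linf_rel_def)
qed

text \<open>The duality pairing with \<open>g \<in> L\<^sup>1([0,\<infinity>), \<real>)\<close>; it is \<open>0\<close> by convention if \<open>g\<close> is not integrable.\<close>

lift_definition linf_pairing :: "linf \<Rightarrow> (real \<Rightarrow> real) \<Rightarrow> real" is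
  "\<lambda>r g. if integrable (lebesgue_on {0..}) g then (LINT x|lebesgue_on {0..}. r x * g x) else 0"
proof (rule ext)
  fix r s g :: "real \<Rightarrow> real" assume rs: "linf_rel r s"
  have "(LINT x|lebesgue_on {0..}. r x * g x) = (LINT x|lebesgue_on {0..}. s x * g x)"
    if "integrable (lebesgue_on {0..}) g"
  proof (rule integral_cong_AE)
    have "g \<in> borel_measurable (lebesgue_on {0..})" using that by auto
    then show "(\<lambda>x. r x * g x) \<in> borel_measurable (lebesgue_on {0..})"
      "(\<lambda>x. s x * g x) \<in> borel_measurable (lebesgue_on {0..})"
      using rs by (auto simp: linf_rel_def)
    have "AE x in lebesgue_on {0..}. r x = s x" using rs by (auto simp: linf_rel_def)
    then show "AE x in lebesgue_on {0..}. r x * g x = s x * g x" by eventually_elim simp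
  qed
  then show "(if integrable (lebesgue_on {0..}) g then (LINT x|lebesgue_on {0..}. r x * g x) else 0) =
      (if integrable (lebesgue_on {0..}) g then (LINT x|lebesgue_on {0..}. s x * g x) else 0)"
    by simp
qed

text \<open>The type \<open>linf\<close> carries the weak-star topology \<open>\<sigma>(L\<^sup>\<infinity>, L\<^sup>1)\<close>, not the norm topology; \<open>borel\<close> and
  \<open>compact\<close> on this type refer to it.\<close>

instantiation linf :: topological_space
begin

definition open_linf :: "linf set \<Rightarrow> bool" where
  "open_linf = generate_topology
     {{r. linf_pairing r g \<in> U} | g U. integrable (lebesgue_on {0..}) g \<and> open U}"

instance
  by intro_classes (auto simp: open_linf_def intro: generate_topology.intros)

end

lift_definition two_valued :: "real \<Rightarrow> linf \<Rightarrow> bool" is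
  "\<lambda>\<alpha> r. AE x in lebesgue_on {0..}. r x \<in> {1, exp \<alpha>}"
proof -
  fix \<alpha> :: real and r s :: "real \<Rightarrow> real" assume "linf_rel r s"
  then have rs: "AE x in lebesgue_on {0..}. r x = s x" by (auto simp: linf_rel_def)
  show "(AE x in lebesgue_on {0..}. r x \<in> {1, exp \<alpha>}) =
      (AE x in lebesgue_on {0..}. s x \<in> {1, exp \<alpha>})" (is "?P = ?Q")
  proof
    assume ?P then show ?Q using rs by eventually_elim simp
  next
    assume ?Q then show ?P using rs by eventually_elim simp
  qed
qed

definition two_valued_set :: "real \<Rightarrow> linf set" where
  "two_valued_set \<alpha> = {r. two_valued \<alpha> r}"

text \<open>The Borel \<open>\<sigma>\<close>-algebra of the subspace \<open>S\<close> is the trace of the ambient one, and a subset of \<open>S\<close> is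
  compact in \<open>S\<close> iff it is compact in the ambient space. Outer regularity and local finiteness need
  not be asked for, the measure being finite.\<close>

definition radon_subprob_on :: "'a::topological_space set \<Rightarrow> 'a measure \<Rightarrow> bool" where
  "radon_subprob_on S M \<longleftrightarrow>
     sets M = sets (restrict_space borel S) \<and> subprob_space M \<and>
     (\<forall>A\<in>sets M. emeasure M A = (SUP K\<in>{K. compact K \<and> K \<subseteq> A}. emeasure M K))"

text \<open>The ball is the one of \<open>\<real>\<close>, so its length is \<open>2\<epsilon>\<close>. The limes superior is taken in the extended
  reals; it is finite because \<open>r\<close> is essentially bounded.\<close>

lift_definition eval_at :: "real \<Rightarrow> linf \<Rightarrow> real" is
  "\<lambda>x r. real_of_ereal (Limsup (at_right 0) (\<lambda>\<epsilon>.
     ereal (1 / measure lebesgue (ball x \<epsilon>) * (LINT y:ball x \<epsilon> \<inter> {0..}|lebesgue. r y))))"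
proof -
  fix x and r s :: "real \<Rightarrow> real" assume "linf_rel r s"
  then have "(LINT y:ball x \<epsilon> \<inter> {0..}|lebesgue. r y) = (LINT y:ball x \<epsilon> \<inter> {0..}|lebesgue. s y)" for \<epsilon>
    by (rule linf_rel_set_integral_cong) auto
  then show "?thesis x r s" by simp
qed

definition private_density :: "real \<Rightarrow> real \<Rightarrow> real" where
  "private_density \<theta> x = 1 / \<theta> * indicator {0..\<theta>} x"

definition private_law :: "real \<Rightarrow> real measure" where
  "private_law \<theta> = density lborel (\<lambda>x. ennreal (private_density \<theta> x))"

definition mechanism :: "linf measure \<Rightarrow> real \<Rightarrow> linf measure" where
  "mechanism \<mu> x = density \<mu> (\<lambda>r. ennreal (eval_at x r))"

lift_definition public_density :: "real \<Rightarrow> linf \<Rightarrow> real" is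
  "\<lambda>\<theta> r. 1 / \<theta> * (LINT x:{0..\<theta>}|lebesgue. r x)"
  by (subst linf_rel_set_integral_cong) auto

definition public_law :: "linf measure \<Rightarrow> real \<Rightarrow> linf measure" where
  "public_law \<mu> \<theta> = density \<mu> (\<lambda>r. ennreal (public_density \<theta> r))"

definition has_densities ::
    "'a measure \<Rightarrow> real set \<Rightarrow> (real \<Rightarrow> 'a measure) \<Rightarrow> (real \<Rightarrow> 'a \<Rightarrow> real) \<Rightarrow> bool" where
  "has_densities M \<Theta> P f \<longleftrightarrow>
     (\<forall>\<theta>\<in>\<Theta>. prob_space (P \<theta>) \<and> f \<theta> \<in> borel_measurable M \<and> (\<forall>x\<in>space M. 0 \<le> f \<theta> x) \<and>
        P \<theta> = density M (\<lambda>x. ennreal (f \<theta> x)))"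

text \<open>Integrability is demanded explicitly because the Bochner integral of a non-integrable
  function is \<open>0\<close>.\<close>

definition dqm_score ::
    "'a measure \<Rightarrow> real set \<Rightarrow> (real \<Rightarrow> 'a \<Rightarrow> real) \<Rightarrow> real \<Rightarrow> ('a \<Rightarrow> real) \<Rightarrow> bool" where
  "dqm_score M \<Theta> f \<theta>\<^sub>0 t \<longleftrightarrow>
     \<theta>\<^sub>0 \<in> interior \<Theta> \<and> t \<in> borel_measurable M \<and>
     (\<forall>\<^sub>F h in at 0. integrable M (\<lambda>x.
        (sqrt (f (\<theta>\<^sub>0 + h) x) - sqrt (f \<theta>\<^sub>0 x) - 1/2 * h * t x * sqrt (f \<theta>\<^sub>0 x))\<^sup>2)) \<and>
     (\<lambda>h. LINT x|M.
        (sqrt (f (\<theta>\<^sub>0 + h) x) - sqrt (f \<theta>\<^sub>0 x) - 1/2 * h * t x * sqrt (f \<theta>\<^sub>0 x))\<^sup>2)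
       \<in> o[at 0](\<lambda>h. h\<^sup>2)"

definition dqm_at ::
    "'a measure \<Rightarrow> real set \<Rightarrow> (real \<Rightarrow> 'a \<Rightarrow> real) \<Rightarrow> real \<Rightarrow> bool" where
  "dqm_at M \<Theta> f \<theta>\<^sub>0 \<longleftrightarrow> (\<exists>t. dqm_score M \<Theta> f \<theta>\<^sub>0 t)"

text \<open>The argument \<open>t\<close> is a score; it is determined by the model only up to sets on which
  \<open>f \<theta>\<^sub>0\<close> vanishes almost everywhere. The value is extended, so that an infinite
  information is not mistaken for \<open>0\<close>.\<close>

definition fisher_information ::
    "'a measure \<Rightarrow> (real \<Rightarrow> 'a \<Rightarrow> real) \<Rightarrow> real \<Rightarrow> ('a \<Rightarrow> real) \<Rightarrow> ennreal" where
  "fisher_information M f \<theta>\<^sub>0 t = (\<integral>\<^sup>+x. ennreal ((t x)\<^sup>2 * f \<theta>\<^sub>0 x) \<partial>M)"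

end

theory Submission
  imports Defs
begin

text \<open>
  Write \<open>K = exp \<alpha>\<close> and \<open>F(\<theta>, r) = \<integral>\<^sub>0\<^sup>\<theta> r\<close>, so that the public density is \<open>f(\<theta>, r) = F(\<theta>, r) / \<theta>\<close>. Every
  \<open>r\<close> in the space of \<open>\<mu>\<close> takes its values in \<open>[1, K]\<close> almost everywhere, hence \<open>F(\<cdot>, r)\<close> is \<open>K\<close>-Lipschitz
  and \<open>f\<close> has its values in \<open>[1, K]\<close>.

  By the Lebesgue differentiation theorem, for fixed \<open>r\<close> the function \<open>F(\<cdot>, r)\<close> is differentiable at
  almost every \<open>x\<close> with derivative \<open>r(x)\<close>. Since \<open>e\<^sub>x(r)\<close> is an upper limit of symmetric difference
  quotients of \<open>F(\<cdot>, r)\<close>, it equals the derivative wherever that exists. \<open>F\<close> is continuous in its first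
  argument and measurable in the second (where it is even weak-star continuous), hence jointly
  measurable; so are \<open>e\<^sub>x(r)\<close> and the set of pairs \<open>(x, r)\<close> at which the derivative exists, because the
  limits involved may be taken along the rationals. Two uses of Fubini's theorem follow. Tonelli applied
  to \<open>f(\<theta>, r) = \<theta>\<^sup>-\<^sup>1 \<integral>\<^sub>0\<^sup>\<theta> e\<^sub>x(r) dx\<close> gives the mixture representation of the public law
  (\<open>emeasure_public_law\<close>), and with it total mass \<open>1\<close>. Exchanging the two ``almost every'' gives
  \<open>AE_AE_regular_at\<close>: for almost every \<open>\<theta>\<^sub>0\<close>, the function \<open>F(\<cdot>, r)\<close> is differentiable at \<open>\<theta>\<^sub>0\<close> with
  derivative \<open>e = e\<^bsub>\<theta>\<^sub>0\<^esub>(r)\<close> for \<open>\<mu>\<close>-almost every \<open>r\<close>.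

  Fix such a \<open>\<theta>\<^sub>0\<close>. The root density \<open>\<surd>f(\<cdot>, r)\<close> is differentiable at \<open>\<theta>\<^sub>0\<close> for almost every \<open>r\<close> and is
  Lipschitz near \<open>\<theta>\<^sub>0\<close> uniformly in \<open>r\<close>, so dominated convergence yields differentiability in quadratic
  mean (\<open>quadratic_mean_derivative\<close>) with score \<open>(e - f) / (\<theta>\<^sub>0 f)\<close>. Finally \<open>e\<close> and \<open>f\<close> both lie in
  \<open>[1, K]\<close> and \<open>f \<ge> 1\<close>, so that
  \<open>((e - f) / (\<theta>\<^sub>0 f))\<^sup>2 f = (e - f)\<^sup>2 / (\<theta>\<^sub>0\<^sup>2 f) \<le> (K - 1)\<^sup>2 / \<theta>\<^sub>0\<^sup>2\<close>; integrating against the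
  sub-probability \<open>\<mu>\<close> gives the bound. It holds for every score because two scores agree almost
  everywhere after multiplication by the root density (\<open>dqm_score_unique\<close>).
\<close>

section \<open>Differentiation of primitives\<close>

lemma diff_eq_mult_quotient_diff: "h \<noteq> 0 \<Longrightarrow> a - h * D = h * (a / h - D)"
  for a h D :: real
  by (simp add: field_simps)

text \<open>The Lebesgue differentiation theorem on the line. The library's one-sided version
  \<open>integrable_ccontinuous_explicit\<close> gives the right derivative of the primitive of \<open>f\<close>; applied to the
  reflected function \<open>y \<mapsto> f (- y)\<close> it gives the left derivative.\<close>

lemma AE_has_real_derivative_primitive:
  fixes f F :: "real \<Rightarrow> real"
  assumes F: "\<And>a b. a \<le> b \<Longrightarrow> (f has_integral (F b - F a)) {a..b}"
  shows "AE x in lebesgue. (F has_real_derivative f x) (at x)"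
proof -
  have int1: "f integrable_on cbox a b" for a b :: real
    using F[of a b] by (cases "a \<le> b") auto
  have refl: "((\<lambda>y. f (- y)) has_integral (F (- a) - F (- b))) {a..b}" if "a \<le> b" for a b
    using F[of "-b" "-a"] that has_integral_reflect_real[of f "F (- a) - F (- b)" "-a" "-b"] by simp
  have int2: "(\<lambda>y. f (- y)) integrable_on cbox a b" for a b :: real
    using refl[of a b] by (cases "a \<le> b") auto
  obtain N where N: "negligible N"
    "\<And>x e. \<lbrakk>x \<notin> N; 0 < e\<rbrakk> \<Longrightarrow> \<exists>d>0. \<forall>h. 0 < h \<and> h < d \<longrightarrow>
        norm (integral (cbox x (x + h *\<^sub>R One)) f /\<^sub>R h ^ DIM(real) - f x) < e"
    using integrable_ccontinuous_explicit[OF int1] by metis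
  obtain N' where N': "negligible N'"
    "\<And>x e. \<lbrakk>x \<notin> N'; 0 < e\<rbrakk> \<Longrightarrow> \<exists>d>0. \<forall>h. 0 < h \<and> h < d \<longrightarrow>
        norm (integral (cbox x (x + h *\<^sub>R One)) (\<lambda>y. f (- y)) /\<^sub>R h ^ DIM(real) - f (- x)) < e"
    using integrable_ccontinuous_explicit[OF int2] by metis
  have "negligible (N \<union> uminus ` N')"
    using N(1) N'(1) by (intro negligible_Un negligible_differentiable_image_negligible)
      (auto intro!: derivative_intros)
  then have "AE x in lebesgue. x \<notin> N \<union> uminus ` N'"
    unfolding negligible_iff_null_sets by (rule AE_not_in)
  then show ?thesis
  proof eventually_elim
    fix x assume x: "x \<notin> N \<union> uminus ` N'"
    then have xN: "x \<notin> N" "- x \<notin> N'" by force+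
    have R: "((\<lambda>h. (F (x + h) - F x) / h) \<longlongrightarrow> f x) (at_right 0)"
    proof (rule tendstoI)
      fix e :: real assume "e > 0"
      then obtain d where d: "d > 0" "\<forall>h. 0 < h \<and> h < d \<longrightarrow>
        norm (integral (cbox x (x + h *\<^sub>R One)) f /\<^sub>R h ^ DIM(real) - f x) < e"
        using N(2) xN by blast
      show "\<forall>\<^sub>F h in at_right 0. dist ((F (x + h) - F x) / h) (f x) < e"
        unfolding eventually_at_right_field
      proof (intro exI[of _ d] conjI allI impI d(1))
        fix h :: real assume h: "0 < h" "h < d"
        have "integral {x..x+h} f = F (x + h) - F x"
          using F[of x "x + h"] h by (auto intro: integral_unique)
        then show "dist ((F (x + h) - F x) / h) (f x) < e"
          using d(2) h by (auto simp: dist_norm divide_inverse_commute)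
      qed
    qed
    have L: "((\<lambda>h. (F (x + h) - F x) / h) \<longlongrightarrow> f x) (at_left 0)"
      unfolding filterlim_at_left_to_right[of _ _ 0]
    proof (rule tendstoI)
      fix e :: real assume "e > 0"
      then obtain d where d: "d > 0" "\<forall>h. 0 < h \<and> h < d \<longrightarrow>
        norm (integral (cbox (- x) (- x + h *\<^sub>R One)) (\<lambda>y. f (- y)) /\<^sub>R h ^ DIM(real) - f x) < e"
        using N'(2)[OF xN(2)] by auto
      show "\<forall>\<^sub>F h in at_right (- 0). dist ((F (x + - h) - F x) / - h) (f x) < e"
        unfolding eventually_at_right_field minus_zero
      proof (intro exI[of _ d] conjI allI impI d(1))
        fix h :: real assume h: "0 < h" "h < d"
        have "integral {- x..- x + h} (\<lambda>y. f (- y)) = F x - F (x - h)"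
          using refl[of "- x" "- x + h"] h by (auto intro: integral_unique)
        then have "norm ((F x - F (x - h)) / h - f x) < e"
          using d(2) h by (auto simp: divide_inverse_commute)
        moreover have "(F (x + - h) - F x) / - h = (F x - F (x - h)) / h"
          using h by (simp add: field_simps)
        ultimately show "dist ((F (x + - h) - F x) / - h) (f x) < e"
          by (simp add: dist_norm)
      qed
    qed
    show "(F has_real_derivative f x) (at x)"
      unfolding DERIV_def using filterlim_split_at[OF L R] .
  qed
qed

lemma closed_superset_of_rats:
  fixes S C :: "real set"
  assumes "open S" "closed C" "S \<inter> \<rat> \<subseteq> C"
  shows "S \<subseteq> C"
proof
  fix x assume "x \<in> S"
  show "x \<in> C"
  proof (rule ccontr)
    assume "x \<notin> C"
    have "open (S - C)" using assms by auto
    then obtain e where e: "e > 0" "ball x e \<subseteq> S - C"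
      using \<open>x \<in> S\<close> \<open>x \<notin> C\<close> by (meson DiffI openE)
    obtain q where q: "q \<in> \<rat>" "x < q" "q < x + e"
      using Rats_dense_in_real[of x "x + e"] \<open>e > 0\<close> by auto
    then have "q \<in> ball x e" by (simp add: ball_eq_greaterThanLessThan)
    then have "q \<in> S - C" using e(2) by blast
    then show False using q(1) assms(3) by auto
  qed
qed

text \<open>By continuity the upper limit may be taken along the rationals, which exhibits it as a countable
  infimum of countable suprema.\<close>

lemma Limsup_at_right_eq_INF_SUP_rats:
  fixes g :: "real \<Rightarrow> real"
  assumes cont: "continuous_on {0<..} g"
  shows "Limsup (at_right 0) (\<lambda>\<epsilon>. ereal (g \<epsilon>)) =
    (INF n. SUP \<epsilon>\<in>\<rat> \<inter> {0<..<inverse (real (Suc n))}. ereal (g \<epsilon>))" (is "_ = (INF n. ?S n)")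
proof (rule antisym)
  show "Limsup (at_right 0) (\<lambda>\<epsilon>. ereal (g \<epsilon>)) \<le> (INF n. ?S n)"
  proof (rule INF_greatest)
    fix n
    let ?I = "{0<..<inverse (real (Suc n))}"
    have "ereal (g \<epsilon>) \<le> ?S n" if "\<epsilon> \<in> ?I" for \<epsilon>
    proof (rule ccontr)
      assume neg: "\<not> ereal (g \<epsilon>) \<le> ?S n"
      have "continuous_on ?I (\<lambda>\<epsilon>. ereal (g \<epsilon>))"
        by (intro continuous_on_ereal continuous_on_subset[OF cont]) auto
      then have "open ((\<lambda>\<epsilon>. ereal (g \<epsilon>)) -` {?S n<..} \<inter> ?I)" (is "open ?U")
        by (rule continuous_on_open_vimage[THEN iffD1, rule_format, rotated]) auto
      moreover have "?U \<inter> \<rat> \<subseteq> {}"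
      proof
        fix q assume q: "q \<in> ?U \<inter> \<rat>"
        then have "ereal (g q) \<le> ?S n" by (intro SUP_upper) auto
        then show "q \<in> {}" using q by auto
      qed
      ultimately have "?U \<subseteq> {}" by (rule closed_superset_of_rats[OF _ closed_empty])
      moreover have "\<epsilon> \<in> ?U" using neg that by (simp add: not_le)
      ultimately show False by blast
    qed
    then show "Limsup (at_right 0) (\<lambda>\<epsilon>. ereal (g \<epsilon>)) \<le> ?S n"
      by (intro Limsup_bounded eventually_at_rightI[of 0 "inverse (real (Suc n))"]) auto
  qed
  show "(INF n. ?S n) \<le> Limsup (at_right 0) (\<lambda>\<epsilon>. ereal (g \<epsilon>))"
    unfolding Limsup_def
  proof (rule INF_greatest)
    fix P assume "P \<in> {P. eventually P (at_right (0::real))}"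
    then obtain d where d: "d > 0" "\<And>y. 0 < y \<Longrightarrow> y < d \<Longrightarrow> P y"
      unfolding eventually_at_right_field by auto
    obtain n where n: "inverse (real (Suc n)) < d" using reals_Archimedean[OF d(1)] by auto
    have "(INF n. ?S n) \<le> ?S n" by (rule INF_lower) simp
    also have "\<dots> \<le> (SUP \<epsilon>\<in>Collect P. ereal (g \<epsilon>))"
      using d n by (intro SUP_subset_mono) auto
    finally show "(INF n. ?S n) \<le> (SUP \<epsilon>\<in>Collect P. ereal (g \<epsilon>))" .
  qed
qed

text \<open>A function continuous in the first and measurable in the second argument (a Caratheodory function)
  is jointly measurable, being the limit of its values at \<open>\<lfloor>n x\<rfloor> / n\<close>.\<close>

lemma borel_measurable_pair_if_continuous:
  fixes F :: "real \<Rightarrow> 'a \<Rightarrow> real"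
  assumes meas: "\<And>x. F x \<in> borel_measurable M"
    and cont: "\<And>r. r \<in> space M \<Longrightarrow> continuous_on UNIV (\<lambda>x. F x r)"
  shows "(\<lambda>p. F (fst p) (snd p)) \<in> borel_measurable (borel \<Otimes>\<^sub>M M)"
proof (rule borel_measurable_LIMSEQ_real)
  let ?x = "\<lambda>n x. real_of_int \<lfloor>real (Suc n) * x\<rfloor> / real (Suc n)"
  fix n
  show "(\<lambda>p. F (?x n (fst p)) (snd p)) \<in> borel_measurable (borel \<Otimes>\<^sub>M M)"
  proof (rule measurable_compose_countable[where g = "\<lambda>p. \<lfloor>real (Suc n) * fst p\<rfloor>"
        and f = "\<lambda>k p. F (real_of_int k / real (Suc n)) (snd p)"])
    show "(\<lambda>p. F (real_of_int k / real (Suc n)) (snd p)) \<in> borel_measurable (borel \<Otimes>\<^sub>M M)" for k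
      by (rule measurable_compose[OF measurable_snd meas])
  qed measurable
next
  let ?x = "\<lambda>n x. real_of_int \<lfloor>real (Suc n) * x\<rfloor> / real (Suc n)"
  fix p assume "p \<in> space (borel \<Otimes>\<^sub>M M :: (real \<times> 'a) measure)"
  then have "snd p \<in> space M" by (auto simp: space_pair_measure)
  have "(\<lambda>n. ?x n (fst p)) \<longlonglongrightarrow> fst p"
  proof (rule tendsto_sandwich)
    show "\<forall>\<^sub>F n in sequentially. fst p - inverse (real (Suc n)) \<le> ?x n (fst p)"
    proof (intro always_eventually allI)
      fix n
      have "real (Suc n) * fst p - 1 \<le> real_of_int \<lfloor>real (Suc n) * fst p\<rfloor>" by linarith
      then have "(real (Suc n) * fst p - 1) / real (Suc n) \<le> ?x n (fst p)"
        by (rule divide_right_mono) simp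
      then show "fst p - inverse (real (Suc n)) \<le> ?x n (fst p)"
        by (simp add: diff_divide_distrib inverse_eq_divide del: of_nat_Suc)
    qed
    show "\<forall>\<^sub>F n in sequentially. ?x n (fst p) \<le> fst p"
    proof (intro always_eventually allI)
      fix n
      have "real_of_int \<lfloor>real (Suc n) * fst p\<rfloor> \<le> real (Suc n) * fst p" by linarith
      then show "?x n (fst p) \<le> fst p"
        by (simp add: divide_le_eq mult.commute del: of_nat_Suc)
    qed
    show "(\<lambda>n. fst p - inverse (real (Suc n))) \<longlonglongrightarrow> fst p"
      using tendsto_diff[OF tendsto_const LIMSEQ_inverse_real_of_nat, of "fst p"] by simp
  qed simp
  then show "(\<lambda>n. F (?x n (fst p)) (snd p)) \<longlonglongrightarrow> F (fst p) (snd p)"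
    using cont[OF \<open>snd p \<in> space M\<close>]
    by (intro isCont_tendsto_compose[where g = "\<lambda>x. F x (snd p)"])
       (auto simp: continuous_on_eq_continuous_at)
qed

text \<open>For continuous \<open>F\<close>, having the derivative \<open>D\<close> at \<open>x\<close> is a countable combination of inequalities.
  Multiplying the difference quotient by \<open>h\<close> makes both sides continuous in \<open>h\<close>, also at \<open>h = 0\<close>.\<close>

lemma has_real_derivative_iff_rats:
  fixes F :: "real \<Rightarrow> real"
  assumes cont: "continuous_on UNIV F"
  shows "(F has_real_derivative D) (at x) \<longleftrightarrow>
    (\<forall>n. \<exists>m. \<forall>h\<in>\<rat>. \<bar>h\<bar> < inverse (real (Suc m)) \<longrightarrow>
        \<bar>F (x + h) - F x - h * D\<bar> \<le> \<bar>h\<bar> * inverse (real (Suc n)))" (is "_ \<longleftrightarrow> ?R")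
proof
  assume "(F has_real_derivative D) (at x)"
  then have lim: "((\<lambda>h. (F (x + h) - F x) / h) \<longlongrightarrow> D) (at 0)" by (simp add: DERIV_def)
  show ?R
  proof
    fix n
    have "\<forall>\<^sub>F h in at 0. dist ((F (x + h) - F x) / h) D < inverse (real (Suc n))"
      by (rule tendstoD[OF lim]) simp
    then obtain d where d: "d > 0"
      "\<And>h. h \<noteq> 0 \<Longrightarrow> \<bar>h\<bar> < d \<Longrightarrow> \<bar>(F (x + h) - F x) / h - D\<bar> < inverse (real (Suc n))"
      unfolding eventually_at dist_real_def by auto
    obtain m where m: "inverse (real (Suc m)) < d" using reals_Archimedean[OF d(1)] by auto
    have "\<bar>F (x + h) - F x - h * D\<bar> \<le> \<bar>h\<bar> * inverse (real (Suc n))"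
      if "\<bar>h\<bar> < inverse (real (Suc m))" for h
    proof (cases "h = 0")
      case False
      have "F (x + h) - F x - h * D = h * ((F (x + h) - F x) / h - D)"
        by (rule diff_eq_mult_quotient_diff[OF False])
      then have "\<bar>F (x + h) - F x - h * D\<bar> = \<bar>h\<bar> * \<bar>(F (x + h) - F x) / h - D\<bar>"
        by (simp only: abs_mult)
      then show ?thesis
        using d(2)[OF False] that m by (simp add: mult_left_mono)
    qed simp
    then show "\<exists>m. \<forall>h\<in>\<rat>. \<bar>h\<bar> < inverse (real (Suc m)) \<longrightarrow>
        \<bar>F (x + h) - F x - h * D\<bar> \<le> \<bar>h\<bar> * inverse (real (Suc n))" by blast
  qed
next
  assume R: ?R
  have "((\<lambda>h. (F (x + h) - F x) / h) \<longlongrightarrow> D) (at 0)"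
  proof (rule tendstoI)
    fix e :: real assume "e > 0"
    then obtain n where n: "inverse (real (Suc n)) < e" using reals_Archimedean by blast
    obtain m where m: "\<And>h. h \<in> \<rat> \<Longrightarrow> \<bar>h\<bar> < inverse (real (Suc m)) \<Longrightarrow>
        \<bar>F (x + h) - F x - h * D\<bar> \<le> \<bar>h\<bar> * inverse (real (Suc n))"
      using R by blast
    have contx: "continuous_on UNIV (\<lambda>h. F (x + h))"
      by (rule continuous_on_compose2[OF cont]) (auto intro!: continuous_intros)
    have "{h. \<bar>h\<bar> < inverse (real (Suc m))} \<subseteq>
        {h. \<bar>F (x + h) - F x - h * D\<bar> \<le> \<bar>h\<bar> * inverse (real (Suc n))}"
    proof (rule closed_superset_of_rats)
      show "open {h::real. \<bar>h\<bar> < inverse (real (Suc m))}"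
        by (intro open_Collect_less continuous_intros)
      show "closed {h. \<bar>F (x + h) - F x - h * D\<bar> \<le> \<bar>h\<bar> * inverse (real (Suc n))}"
        by (intro closed_Collect_le continuous_intros contx)
    qed (use m in auto)
    then have *: "\<bar>F (x + h) - F x - h * D\<bar> \<le> \<bar>h\<bar> * inverse (real (Suc n))"
      if "\<bar>h\<bar> < inverse (real (Suc m))" for h using that by auto
    have "dist ((F (x + h) - F x) / h) D < e" if "h \<noteq> 0" "\<bar>h\<bar> < inverse (real (Suc m))" for h
    proof -
      have "F (x + h) - F x - h * D = h * ((F (x + h) - F x) / h - D)"
        by (rule diff_eq_mult_quotient_diff[OF that(1)])
      then have "\<bar>F (x + h) - F x - h * D\<bar> = \<bar>h\<bar> * \<bar>(F (x + h) - F x) / h - D\<bar>"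
        by (simp only: abs_mult)
      then have "\<bar>(F (x + h) - F x) / h - D\<bar> \<le> inverse (real (Suc n))"
        using *[OF that(2)] that(1) by simp
      then show ?thesis using n by (simp add: dist_real_def)
    qed
    then show "\<forall>\<^sub>F h in at 0. dist ((F (x + h) - F x) / h) D < e"
      unfolding eventually_at by (intro exI[of _ "inverse (real (Suc m))"]) (auto simp: dist_real_def)
  qed
  then show "(F has_real_derivative D) (at x)" by (simp add: DERIV_def)
qed

section \<open>Differentiability in quadratic mean\<close>

text \<open>A pointwise almost everywhere derivative is a derivative in quadratic mean as soon as the
  difference quotients near \<open>\<theta>\<^sub>0\<close> are bounded by a constant: the squared error, divided by \<open>h\<^sup>2\<close>, tends to zero
  almost everywhere and is bounded by \<open>(2 C)\<^sup>2\<close>. Here \<open>g\<close> stands for the root density.\<close>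

lemma quadratic_mean_derivative:
  fixes g :: "real \<Rightarrow> 'a \<Rightarrow> real"
  assumes "finite_measure M"
    and g [measurable]: "\<And>\<theta>. g \<theta> \<in> borel_measurable M" and D [measurable]: "D \<in> borel_measurable M"
    and "\<delta> > 0"
    and lip: "\<And>h x. \<bar>h\<bar> < \<delta> \<Longrightarrow> x \<in> space M \<Longrightarrow> \<bar>g (\<theta>\<^sub>0 + h) x - g \<theta>\<^sub>0 x\<bar> \<le> C * \<bar>h\<bar>"
    and deriv: "AE x in M. ((\<lambda>\<theta>. g \<theta> x) has_real_derivative D x) (at \<theta>\<^sub>0)"
  shows "\<forall>\<^sub>F h in at 0. integrable M (\<lambda>x. (g (\<theta>\<^sub>0 + h) x - g \<theta>\<^sub>0 x - h * D x)\<^sup>2)" (is ?int)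
    and "(\<lambda>h. LINT x|M. (g (\<theta>\<^sub>0 + h) x - g \<theta>\<^sub>0 x - h * D x)\<^sup>2) \<in> o[at 0](\<lambda>h. h\<^sup>2)" (is ?o)
proof -
  interpret finite_measure M by fact
  define Q where "Q h x = ((g (\<theta>\<^sub>0 + h) x - g \<theta>\<^sub>0 x) / h - D x)\<^sup>2" for h x
  have Qm [measurable]: "Q h \<in> borel_measurable M" for h
    unfolding Q_def by measurable
  have R: "(g (\<theta>\<^sub>0 + h) x - g \<theta>\<^sub>0 x - h * D x)\<^sup>2 = h\<^sup>2 * Q h x" if "h \<noteq> 0" for h x
    unfolding Q_def power_mult_distrib[symmetric] diff_eq_mult_quotient_diff[OF that] ..
  have quot: "\<bar>(g (\<theta>\<^sub>0 + h) x - g \<theta>\<^sub>0 x) / h\<bar> \<le> C" if "h \<noteq> 0" "\<bar>h\<bar> < \<delta>" "x \<in> space M" for h x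
    using lip[of h x] that by (simp add: abs_divide divide_le_eq)
  have lim: "AE x in M. ((\<lambda>h. (g (\<theta>\<^sub>0 + h) x - g \<theta>\<^sub>0 x) / h) \<longlongrightarrow> D x) (at 0)"
    using deriv by eventually_elim (simp add: DERIV_def)
  have near: "\<forall>\<^sub>F h in at (0::real). h \<noteq> 0 \<and> \<bar>h\<bar> < \<delta>"
    unfolding eventually_at using \<open>\<delta> > 0\<close> by (intro exI[of _ \<delta>]) auto
  have DC: "AE x in M. \<bar>D x\<bar> \<le> C"
    using lim AE_space
  proof eventually_elim
    case (elim x)
    have "\<forall>\<^sub>F h in at 0. \<bar>(g (\<theta>\<^sub>0 + h) x - g \<theta>\<^sub>0 x) / h\<bar> \<le> C"
      using near by eventually_elim (use elim(2) in \<open>blast intro: quot\<close>)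
    then show ?case by (rule tendsto_upperbound[OF tendsto_rabs[OF elim(1)]]) simp
  qed
  have bound: "AE x in M. norm (Q h x) \<le> (2 * C)\<^sup>2" if h: "h \<noteq> 0" "\<bar>h\<bar> < \<delta>" for h
    using DC AE_space
  proof eventually_elim
    case (elim x)
    have "\<bar>(g (\<theta>\<^sub>0 + h) x - g \<theta>\<^sub>0 x) / h - D x\<bar> \<le> 2 * C"
      using quot[OF h elim(2)] elim(1) by linarith
    from power_mono[OF this abs_ge_zero, of 2] show ?case unfolding Q_def by simp
  qed
  have Qint: "integrable M (Q h)" if "h \<noteq> 0" "\<bar>h\<bar> < \<delta>" for h
    using bound[OF that] by (rule integrable_const_bound) measurable
  show ?int
    using near by eventually_elim (simp add: R Qint)
  have "((\<lambda>h. LINT x|M. Q h x) \<longlongrightarrow> (LINT x|M. 0)) (at 0)"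
    unfolding tendsto_at_iff_sequentially comp_def
  proof (intro allI impI)
    fix X :: "nat \<Rightarrow> real" assume X0: "\<forall>i. X i \<in> UNIV - {0}" and X: "X \<longlonglongrightarrow> 0"
    \<comment> \<open>The domination holds for \<open>\<bar>h\<bar> < \<delta>\<close> only, so finitely many terms are dropped.\<close>
    obtain N where N: "\<And>n. n \<ge> N \<Longrightarrow> \<bar>X n\<bar> < \<delta>"
      using LIMSEQ_D[OF X \<open>\<delta> > 0\<close>] by auto
    have XN: "(\<lambda>n. X (n + N)) \<longlonglongrightarrow> 0" using X by (rule LIMSEQ_ignore_initial_segment)
    have at0: "filterlim (\<lambda>n. X (n + N)) (at 0) sequentially"
      using XN X0 by (auto simp: filterlim_at)
    have "(\<lambda>n. LINT x|M. Q (X (n + N)) x) \<longlonglongrightarrow> (LINT x|M. 0)"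
    proof (rule integral_dominated_convergence[where w = "\<lambda>_. (2 * C)\<^sup>2"])
      show "AE x in M. (\<lambda>n. Q (X (n + N)) x) \<longlonglongrightarrow> 0"
        using lim
      proof eventually_elim
        case (elim x)
        have "((\<lambda>h. Q h x) \<longlongrightarrow> (D x - D x)\<^sup>2) (at 0)"
          unfolding Q_def by (intro tendsto_power tendsto_diff elim tendsto_const)
        then show ?case using filterlim_compose[OF _ at0] by simp
      qed
      show "AE x in M. norm (Q (X (n + N)) x) \<le> (2 * C)\<^sup>2" for n
        using X0 N[of "n + N"] by (intro bound) auto
    qed auto
    then show "(\<lambda>n. LINT x|M. Q (X n) x) \<longlonglongrightarrow> (LINT x|M. 0)"
      by (rule LIMSEQ_offset)
  qed
  then have Q0: "((\<lambda>h. LINT x|M. Q h x) \<longlongrightarrow> 0) (at 0)" by simp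
  show ?o
  proof (rule smalloI_tendsto)
    show "((\<lambda>h. (LINT x|M. (g (\<theta>\<^sub>0 + h) x - g \<theta>\<^sub>0 x - h * D x)\<^sup>2) / h\<^sup>2) \<longlongrightarrow> 0) (at 0)"
    proof (rule Lim_transform_eventually[OF Q0])
      show "\<forall>\<^sub>F h in at 0. (LINT x|M. Q h x) =
          (LINT x|M. (g (\<theta>\<^sub>0 + h) x - g \<theta>\<^sub>0 x - h * D x)\<^sup>2) / h\<^sup>2"
        using near by eventually_elim (simp add: R)
    qed
    show "\<forall>\<^sub>F h in at 0. (h::real)\<^sup>2 \<noteq> 0" using near by eventually_elim simp
  qed
qed

text \<open>With \<open>d\<close> the difference of two scores times the root density, \<open>h\<^sup>2 d\<^sup>2\<close> is at most a multiple of the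
  sum of the two squared remainders. Hence \<open>h\<^sup>2 \<integral> d\<^sup>2 = o(h\<^sup>2)\<close>, which forces \<open>d = 0\<close> almost everywhere.\<close>

lemma dqm_score_unique:
  assumes t: "dqm_score M \<Theta> f \<theta>\<^sub>0 t" and t': "dqm_score M \<Theta> f \<theta>\<^sub>0 t'"
    and fm [measurable]: "f \<theta>\<^sub>0 \<in> borel_measurable M"
  shows "AE x in M. t x * sqrt (f \<theta>\<^sub>0 x) = t' x * sqrt (f \<theta>\<^sub>0 x)"
proof -
  define R where "R s h x = sqrt (f (\<theta>\<^sub>0 + h) x) - sqrt (f \<theta>\<^sub>0 x) - 1/2 * h * s x * sqrt (f \<theta>\<^sub>0 x)"
    for s h x
  define d where "d x = (t x - t' x) * sqrt (f \<theta>\<^sub>0 x)" for x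
  have [measurable]: "t \<in> borel_measurable M" "t' \<in> borel_measurable M"
    using t t' by (auto simp: dqm_score_def)
  have dm [measurable]: "d \<in> borel_measurable M" unfolding d_def by measurable
  have I: "\<forall>\<^sub>F h in at 0. integrable M (\<lambda>x. (R t h x)\<^sup>2)" "\<forall>\<^sub>F h in at 0. integrable M (\<lambda>x. (R t' h x)\<^sup>2)"
    and o: "(\<lambda>h. LINT x|M. (R t h x)\<^sup>2) \<in> o[at 0](\<lambda>h. h\<^sup>2)" "(\<lambda>h. LINT x|M. (R t' h x)\<^sup>2) \<in> o[at 0](\<lambda>h. h\<^sup>2)"
    using t t' by (auto simp: dqm_score_def R_def)
  have hd: "h\<^sup>2 * (d x)\<^sup>2 \<le> 8 * ((R t h x)\<^sup>2 + (R t' h x)\<^sup>2)" for h x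
  proof -
    have "h * d x = 2 * (R t' h x - R t h x)" by (simp add: R_def d_def algebra_simps)
    then have "h\<^sup>2 * (d x)\<^sup>2 = (2 * (R t' h x - R t h x))\<^sup>2"
      by (simp only: power_mult_distrib[symmetric])
    then have "h\<^sup>2 * (d x)\<^sup>2 = 4 * (R t' h x - R t h x)\<^sup>2"
      by (simp only: power_mult_distrib) simp
    moreover have "(R t' h x - R t h x)\<^sup>2 \<le> 2 * ((R t h x)\<^sup>2 + (R t' h x)\<^sup>2)"
      using zero_le_power2[of "R t' h x + R t h x"] by (simp add: power2_eq_square algebra_simps)
    ultimately show ?thesis by linarith
  qed
  have small: "integrable M (\<lambda>x. (d x)\<^sup>2) \<and> (LINT x|M. (d x)\<^sup>2) \<le> 16 * c" if "c > 0" for c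
  proof -
    have "\<forall>\<^sub>F h in at (0::real). h \<noteq> 0" by (rule eventually_neq_at_within)
    with landau_o.smallD[OF o(1) \<open>c > 0\<close>] landau_o.smallD[OF o(2) \<open>c > 0\<close>] I
    have "\<forall>\<^sub>F h in at 0. h \<noteq> 0 \<and> integrable M (\<lambda>x. (R t h x)\<^sup>2) \<and> integrable M (\<lambda>x. (R t' h x)\<^sup>2)
        \<and> norm (LINT x|M. (R t h x)\<^sup>2) \<le> c * norm (h\<^sup>2) \<and> norm (LINT x|M. (R t' h x)\<^sup>2) \<le> c * norm (h\<^sup>2)"
      by eventually_elim blast
    then obtain h where h: "h \<noteq> 0"
      and int: "integrable M (\<lambda>x. (R t h x)\<^sup>2)" "integrable M (\<lambda>x. (R t' h x)\<^sup>2)"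
      and le: "norm (LINT x|M. (R t h x)\<^sup>2) \<le> c * norm (h\<^sup>2)" "norm (LINT x|M. (R t' h x)\<^sup>2) \<le> c * norm (h\<^sup>2)"
      using eventually_happens'[OF at_neq_bot] by blast
    let ?S = "\<lambda>x. 8 * ((R t h x)\<^sup>2 + (R t' h x)\<^sup>2)"
    have S: "integrable M ?S" using int by simp
    have hdint: "integrable M (\<lambda>x. h\<^sup>2 * (d x)\<^sup>2)"
    proof (rule Bochner_Integration.integrable_bound[OF S])
      show "AE x in M. norm (h\<^sup>2 * (d x)\<^sup>2) \<le> norm (?S x)"
      proof (rule AE_I2)
        fix x show "norm (h\<^sup>2 * (d x)\<^sup>2) \<le> norm (?S x)" using hd[of h x] by simp
      qed
    qed measurable
    then have dint: "integrable M (\<lambda>x. (d x)\<^sup>2)" using h by simp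
    have "h\<^sup>2 * (LINT x|M. (d x)\<^sup>2) = (LINT x|M. h\<^sup>2 * (d x)\<^sup>2)" by simp
    also have "\<dots> \<le> (LINT x|M. ?S x)" by (intro integral_mono hdint S hd)
    also have "\<dots> = 8 * ((LINT x|M. (R t h x)\<^sup>2) + (LINT x|M. (R t' h x)\<^sup>2))" using int by simp
    also have "\<dots> \<le> h\<^sup>2 * (16 * c)" using le by (simp add: algebra_simps)
    finally show ?thesis using h dint by simp
  qed
  have int: "integrable M (\<lambda>x. (d x)\<^sup>2)" using small[of 1] by simp
  have "(LINT x|M. (d x)\<^sup>2) \<le> 0"
  proof (rule field_le_epsilon)
    fix e :: real assume "0 < e"
    then show "(LINT x|M. (d x)\<^sup>2) \<le> 0 + e" using small[of "e / 16"] by simp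
  qed
  then have "(LINT x|M. (d x)\<^sup>2) = 0" by (simp add: antisym)
  then have "AE x in M. (d x)\<^sup>2 = 0"
    using integral_nonneg_eq_0_iff_AE[OF int] by simp
  then show ?thesis by eventually_elim (auto simp: d_def left_diff_distrib)
qed

lemma fisher_information_cong_score:
  assumes "dqm_score M \<Theta> f \<theta>\<^sub>0 t" "dqm_score M \<Theta> f \<theta>\<^sub>0 t'"
    and "f \<theta>\<^sub>0 \<in> borel_measurable M" and nonneg: "\<And>x. x \<in> space M \<Longrightarrow> 0 \<le> f \<theta>\<^sub>0 x"
  shows "fisher_information M f \<theta>\<^sub>0 t = fisher_information M f \<theta>\<^sub>0 t'"
  unfolding fisher_information_def
proof (rule nn_integral_cong_AE)
  show "AE x in M. ennreal ((t x)\<^sup>2 * f \<theta>\<^sub>0 x) = ennreal ((t' x)\<^sup>2 * f \<theta>\<^sub>0 x)"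
    using dqm_score_unique[OF assms(1-3)] AE_space
  proof eventually_elim
    case (elim x)
    have *: "(s x)\<^sup>2 * f \<theta>\<^sub>0 x = (s x * sqrt (f \<theta>\<^sub>0 x))\<^sup>2" for s :: "'a \<Rightarrow> real"
      using nonneg[OF elim(2)] by (simp add: power_mult_distrib)
    show ?case unfolding * elim(1) ..
  qed
qed

lemma abs_sqrt_diff_le:
  assumes "1 \<le> a" "1 \<le> b"
  shows "\<bar>sqrt a - sqrt b\<bar> \<le> \<bar>a - b\<bar>"
proof -
  have "a - b = (sqrt a - sqrt b) * (sqrt a + sqrt b)"
    using assms by (simp add: algebra_simps)
  then have "\<bar>a - b\<bar> = \<bar>sqrt a - sqrt b\<bar> * \<bar>sqrt a + sqrt b\<bar>" by (simp only: abs_mult)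
  moreover have "1 \<le> \<bar>sqrt a + sqrt b\<bar>"
    using assms real_sqrt_ge_one[of a] real_sqrt_ge_one[of b] by linarith
  ultimately show ?thesis
    using mult_left_mono[of 1 "\<bar>sqrt a + sqrt b\<bar>" "\<bar>sqrt a - sqrt b\<bar>"] by simp
qed

section \<open>The primitive of a class in \<open>L\<^sup>\<infinity>\<close>\<close>

text \<open>The primitive \<open>\<theta> \<mapsto> \<integral>\<^sub>0\<^sup>\<theta> r\<close> of a class \<open>r\<close>, as a value of the duality pairing. It is \<open>0\<close> for
  negative \<open>\<theta>\<close>.\<close>

definition cumul :: "real \<Rightarrow> linf \<Rightarrow> real" where
  "cumul \<theta> r = linf_pairing r (indicator {0..\<theta>})"

lemma integrable_indicator_atLeastAtMost:
  "integrable (lebesgue_on {0..}) (indicator {0..\<theta>} :: real \<Rightarrow> real)"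
proof -
  have "{0..\<theta>} \<inter> {0..} = {0..\<theta>}" by auto
  then have "integrable lebesgue (\<lambda>x. indicator {0..} x *\<^sub>R (indicator {0..\<theta>} x :: real))"
    by (simp add: indicator_inter_arith[symmetric] Int_commute integrable_indicator_iff
        emeasure_lborel_Icc_eq)
  then show ?thesis
    by (subst integrable_restrict_space) auto
qed

lemma cumul_abs_linf:
  assumes "linf_rel f f"
  shows "cumul \<theta> (abs_linf f) = (LINT x:{0..\<theta>}|lebesgue. f x)"
proof -
  have "cumul \<theta> (abs_linf f) = (LINT x|lebesgue_on {0..}. f x * indicator {0..\<theta>} x)"
    unfolding cumul_def linf_pairing.abs_eq[OF assms]
    by (simp add: integrable_indicator_atLeastAtMost)
  also have "\<dots> = (LINT x:{0..\<theta>}|lebesgue. f x)"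
    unfolding set_lebesgue_integral_def
    by (subst integral_restrict_space) (auto intro!: Bochner_Integration.integral_cong simp: indicator_def)
  finally show ?thesis .
qed

lemma public_density_eq_cumul: "public_density \<theta> r = cumul \<theta> r / \<theta>"
proof (induction r rule: linf.abs_induct)
  case (1 f)
  then show ?case by (simp add: public_density.abs_eq cumul_abs_linf)
qed

lemma cumul_zero: "cumul 0 r = 0"
proof (induction r rule: linf.abs_induct)
  case (1 f)
  have "AE x in lebesgue. x \<noteq> (0::real)"
    unfolding AE_completion_iff by (rule AE_lborel_singleton)
  then have "AE x in lebesgue. indicator {0..0} x *\<^sub>R f x = 0"
    by eventually_elim simp
  then show ?case
    unfolding cumul_abs_linf[OF 1] set_lebesgue_integral_def by (rule integral_eq_zero_AE)
qed

lemma continuous_on_linf_pairing: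
  assumes "integrable (lebesgue_on {0..}) g"
  shows "continuous_on UNIV (\<lambda>r. linf_pairing r g)"
  unfolding continuous_on_open_vimage[OF open_UNIV]
proof (intro allI impI)
  fix U :: "real set" assume "open U"
  then have "{r. linf_pairing r g \<in> U} \<in>
      {{r. linf_pairing r g \<in> U} | g U. integrable (lebesgue_on {0..}) g \<and> open U}"
    using assms by blast
  then have "open {r. linf_pairing r g \<in> U}"
    unfolding open_linf_def by (rule generate_topology.Basis)
  then show "open ((\<lambda>r. linf_pairing r g) -` U \<inter> UNIV)"
    by (simp add: vimage_def)
qed

lemma borel_measurable_cumul: "cumul \<theta> \<in> borel_measurable borel"
  unfolding cumul_def
  by (intro borel_measurable_continuous_onI continuous_on_linf_pairing
      integrable_indicator_atLeastAtMost)

text \<open>A representative of \<open>r\<close> that satisfies its bounds everywhere, with value \<open>0\<close> on the negative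
  half-line. With this choice the restriction of the ball to \<open>{0..}\<close> in \<open>eval_at\<close> has no effect, and the
  averages become symmetric difference quotients of \<open>cumul\<close> at every real \<open>x\<close>.\<close>

lemma two_valued_representative:
  assumes r: "r \<in> two_valued_set \<alpha>" and "\<alpha> > 0"
  obtains f where "\<forall>x<0. f x = 0" and "\<forall>x\<ge>0. f x \<in> {1..exp \<alpha>}"
    and "\<forall>a b. a \<le> b \<longrightarrow> (f has_integral (cumul b r - cumul a r)) {a..b}"
    and "\<forall>x. eval_at x r = real_of_ereal (Limsup (at_right 0)
          (\<lambda>\<epsilon>. ereal ((cumul (x + \<epsilon>) r - cumul (x - \<epsilon>) r) / (2 * \<epsilon>))))"
proof -
  let ?K = "exp \<alpha>"
  have rr: "linf_rel (rep_linf r) (rep_linf r)"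
    using Quotient3_linf by (rule Quotient3_rep_reflp)
  have two: "AE x in lebesgue_on {0..}. rep_linf r x \<in> {1, ?K}"
    using r by (simp add: two_valued_set_def two_valued.rep_eq)
  \<comment> \<open>Clamping to \<open>[1, ?K]\<close> changes the representative on a null set only.\<close>
  define f where "f x = indicator {0..} x * (max 1 (min ?K (rep_linf r x)))" for x
  have "rep_linf r \<in> borel_measurable (lebesgue_on {0..})"
    using rr by (simp add: linf_rel_def)
  then have "(\<lambda>x. max 1 (min ?K (rep_linf r x))) \<in> borel_measurable (lebesgue_on {0..})"
    by measurable
  then have fm: "f \<in> borel_measurable lebesgue"
    unfolding f_def by (subst (asm) borel_measurable_restrict_space_iff) auto
  have f0: "f x = 0" if "x < 0" for x using that by (simp add: f_def)
  have fK: "f x \<in> {1..?K}" if "0 \<le> x" for x using that \<open>\<alpha> > 0\<close> by (auto simp: f_def)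
  have fb: "\<bar>f x\<bar> \<le> ?K" for x using f0[of x] fK[of x] by (cases "x < 0") auto
  have eq: "AE x in lebesgue_on {0..}. rep_linf r x = f x"
    using two AE_space
    by eventually_elim (use \<open>\<alpha> > 0\<close> in \<open>auto simp: f_def\<close>)
  have rf: "linf_rel (rep_linf r) f"
    using rr eq measurable_restrict_space1[OF fm] by (simp add: linf_rel_def)
  have ff: "linf_rel f f"
    using fb measurable_restrict_space1[OF fm] by (auto simp: linf_rel_def)
  have rf': "r = abs_linf f"
    using rf Quotient3_rel[OF Quotient3_linf, of "rep_linf r" f] Quotient3_abs_rep[OF Quotient3_linf, of r]
    by simp
  have cum: "cumul \<theta> r = (LINT x:{0..\<theta>}|lebesgue. f x)" for \<theta>
    unfolding rf' using ff by (rule cumul_abs_linf)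
  have absint: "set_integrable lebesgue {a..b} f" for a b
    unfolding set_integrable_def
    by (rule integrableI_bounded_set_indicator[where B="?K"]) (use fm fb in \<open>auto simp: emeasure_lborel_Icc_eq\<close>)
  have absint': "f absolutely_integrable_on {a..b}" for a b by (rule absint)
  have int: "f integrable_on {a..b}" for a b
    using absint'[of a b] by (rule absolutely_integrable_on_def[THEN iffD1, THEN conjunct1])
  have LI: "(LINT x:{a..b}|lebesgue. f x) = integral {a..b} f" for a b
    using absint'[of a b] by (rule set_lebesgue_integral_eq_integral)
  have cum': "cumul \<theta> r = integral {0..\<theta>} f" for \<theta>
    unfolding cum LI ..
  have zero: "integral {a..b} f = 0" if "b \<le> 0" for a b
  proof -
    have "integral {a..b} f = integral {a..b} (\<lambda>_. 0)"
      by (rule integral_spike[of "{0}"]) (use that f0 in auto)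
    then show ?thesis by simp
  qed
  have hi: "(f has_integral (cumul b r - cumul a r)) {a..b}" if "a \<le> b" for a b
  proof -
    have "integral {a..b} f = cumul b r - cumul a r"
    proof (cases "0 \<le> a")
      case True
      then show ?thesis
        using Henstock_Kurzweil_Integration.integral_combine[of 0 a b f] int that unfolding cum' by auto
    next
      case False
      then have "integral {a..b} f = integral {0..b} f"
      proof (cases "0 \<le> b")
        case True
        then show ?thesis
          using Henstock_Kurzweil_Integration.integral_combine[of a 0 b f] int zero[of 0 a] False by auto
      qed (use zero[of b a] in auto)
      then show ?thesis using False unfolding cum' by simp
    qed
    then show ?thesis using int[of a b] by (metis integrable_integral)
  qed
  have ball: "(LINT y:ball x \<epsilon> \<inter> {0..}|lebesgue. f y) = cumul (x + \<epsilon>) r - cumul (x - \<epsilon>) r"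
    if "\<epsilon> > 0" for x \<epsilon>
  proof -
    have "(LINT y:ball x \<epsilon> \<inter> {0..}|lebesgue. f y) = (LINT y:{x-\<epsilon>..x+\<epsilon>}|lebesgue. f y)"
      unfolding set_lebesgue_integral_def
    proof (rule integral_cong_AE)
      have "AE y in lebesgue. y \<noteq> x - \<epsilon> \<and> y \<noteq> x + \<epsilon>"
        using AE_lborel_singleton[of "x - \<epsilon>"] AE_lborel_singleton[of "x + \<epsilon>"]
        unfolding AE_completion_iff by eventually_elim auto
      then show "AE y in lebesgue. indicat_real (ball x \<epsilon> \<inter> {0..}) y *\<^sub>R f y = indicat_real {x-\<epsilon>..x+\<epsilon>} y *\<^sub>R f y"
        by eventually_elim (use f0 in \<open>auto simp: indicator_def ball_eq_greaterThanLessThan\<close>)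
    qed (use fm in \<open>auto intro!: borel_measurable_times borel_measurable_indicator\<close>)
    also have "\<dots> = cumul (x + \<epsilon>) r - cumul (x - \<epsilon>) r"
      unfolding LI using hi[of "x - \<epsilon>" "x + \<epsilon>"] that by (auto intro: integral_unique)
    finally show ?thesis .
  qed
  have ev: "eval_at x r = real_of_ereal (Limsup (at_right 0)
          (\<lambda>\<epsilon>. ereal ((cumul (x + \<epsilon>) r - cumul (x - \<epsilon>) r) / (2 * \<epsilon>))))" for x
  proof -
    have "\<forall>\<^sub>F \<epsilon> in at_right 0. ereal (1 / measure lebesgue (ball x \<epsilon>) * (LINT y:ball x \<epsilon> \<inter> {0..}|lebesgue. f y))
       = ereal ((cumul (x + \<epsilon>) r - cumul (x - \<epsilon>) r) / (2 * \<epsilon>))"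
      using eventually_at_right_less[of 0]
    proof eventually_elim
      case (elim \<epsilon>)
      then have "measure lebesgue (ball x \<epsilon>) = 2 * \<epsilon>" by (simp add: ball_eq_greaterThanLessThan)
      then show ?case unfolding ball[OF elim] by simp
    qed
    from Limsup_eq[OF this] show ?thesis
      by (subst rf') (simp only: eval_at.abs_eq[OF ff])
  qed
  show thesis using f0 fK hi ev by (intro that[of f]) auto
qed

section \<open>Joint measurability and almost everywhere differentiability\<close>

text \<open>A Radon sub-probability measure on the extreme points. Nothing is assumed here about the mean of
  the evaluation operator.\<close>

locale two_valued_radon_measure =
  fixes \<alpha> :: real and \<mu> :: "linf measure"
  assumes alpha_pos: "\<alpha> > 0"
    and radon: "radon_subprob_on (two_valued_set \<alpha>) \<mu>"
begin

sublocale subprob_space \<mu>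
  using radon by (simp add: radon_subprob_on_def)

lemma sets_mu: "sets \<mu> = sets (restrict_space borel (two_valued_set \<alpha>))"
  using radon by (simp add: radon_subprob_on_def)

lemma space_mu: "space \<mu> = two_valued_set \<alpha>"
  using sets_eq_imp_space_eq[OF sets_mu] by (simp add: space_restrict_space)

lemma borel_measurable_cumul_mu [measurable]: "cumul x \<in> borel_measurable \<mu>"
  using measurable_restrict_space1[OF borel_measurable_cumul]
  by (simp cong: measurable_cong_sets add: sets_mu)

lemma cumul_increment_bounds:
  assumes r: "r \<in> space \<mu>" and "a \<le> b"
  shows "0 \<le> cumul b r - cumul a r" "cumul b r - cumul a r \<le> exp \<alpha> * (b - a)"
    and "0 \<le> a \<Longrightarrow> b - a \<le> cumul b r - cumul a r"
proof -
  obtain f where f0: "\<forall>x<0. f x = 0" and fK: "\<forall>x\<ge>0. f x \<in> {1..exp \<alpha>}"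
    and f: "\<forall>a b. a \<le> b \<longrightarrow> (f has_integral (cumul b r - cumul a r)) {a..b}"
    and "\<forall>x. eval_at x r = real_of_ereal (Limsup (at_right 0)
          (\<lambda>\<epsilon>. ereal ((cumul (x + \<epsilon>) r - cumul (x - \<epsilon>) r) / (2 * \<epsilon>))))"
    by (rule two_valued_representative[OF r[unfolded space_mu] alpha_pos])
  note f = f[rule_format]
  have nn: "0 \<le> f x" "f x \<le> exp \<alpha>" for x
    using f0[rule_format, of x] fK[rule_format, of x] by (cases "x < 0"; force)+
  show "0 \<le> cumul b r - cumul a r"
    by (rule has_integral_nonneg[OF f[OF \<open>a \<le> b\<close>]]) (rule nn)
  have "cumul b r - cumul a r \<le> measure lborel {a..b} *\<^sub>R exp \<alpha>"
    by (rule has_integral_le[OF f[OF \<open>a \<le> b\<close>] has_integral_const_real]) (rule nn)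
  then show "cumul b r - cumul a r \<le> exp \<alpha> * (b - a)"
    using \<open>a \<le> b\<close> by (simp add: mult.commute)
  show "b - a \<le> cumul b r - cumul a r" if "0 \<le> a"
  proof -
    have "1 \<le> f x" if "x \<in> {a..b}" for x using fK[rule_format, of x] that \<open>0 \<le> a\<close> by auto
    then have "measure lborel {a..b} *\<^sub>R 1 \<le> cumul b r - cumul a r"
      by (rule has_integral_le[OF has_integral_const_real f[OF \<open>a \<le> b\<close>]])
    then show ?thesis using \<open>a \<le> b\<close> by simp
  qed
qed

lemma cumul_lipschitz: "r \<in> space \<mu> \<Longrightarrow> \<bar>cumul b r - cumul a r\<bar> \<le> exp \<alpha> * \<bar>b - a\<bar>"
  using cumul_increment_bounds[of r a b] cumul_increment_bounds[of r b a]
  by (cases "a \<le> b") (auto simp: abs_if)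

lemma cumul_bounds:
  assumes "r \<in> space \<mu>" "0 \<le> x"
  shows "x \<le> cumul x r" "cumul x r \<le> exp \<alpha> * x"
  using cumul_increment_bounds[OF assms] cumul_zero by auto

lemma continuous_cumul:
  assumes "r \<in> space \<mu>" shows "continuous_on UNIV (\<lambda>x. cumul x r)"
proof -
  have "(exp \<alpha>)-lipschitz_on UNIV (\<lambda>x. cumul x r)"
    using cumul_lipschitz[OF assms] by (intro lipschitz_onI) (auto simp: dist_real_def abs_minus_commute)
  then show ?thesis by (rule lipschitz_on_continuous_on)
qed

lemma borel_measurable_cumul_pair [measurable]:
  "(\<lambda>p. cumul (fst p) (snd p)) \<in> borel_measurable (borel \<Otimes>\<^sub>M \<mu>)"
  by (intro borel_measurable_pair_if_continuous borel_measurable_cumul_mu continuous_cumul)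

lemma borel_measurable_cumul_compose:
  assumes "f \<in> borel_measurable M" "g \<in> measurable M \<mu>"
  shows "(\<lambda>z. cumul (f z) (g z)) \<in> borel_measurable M"
  using measurable_compose[OF measurable_Pair[OF assms] borel_measurable_cumul_pair] by simp

lemma eval_at_eq_Limsup:
  assumes "r \<in> space \<mu>"
  shows "eval_at x r = real_of_ereal (Limsup (at_right 0)
          (\<lambda>\<epsilon>. ereal ((cumul (x + \<epsilon>) r - cumul (x - \<epsilon>) r) / (2 * \<epsilon>))))"
proof (rule two_valued_representative[OF assms[unfolded space_mu] alpha_pos])
  assume "\<forall>x. eval_at x r = real_of_ereal (Limsup (at_right 0)
          (\<lambda>\<epsilon>. ereal ((cumul (x + \<epsilon>) r - cumul (x - \<epsilon>) r) / (2 * \<epsilon>))))"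
  then show ?thesis ..
qed

lemma borel_measurable_eval_at_pair [measurable]:
  "(\<lambda>p. eval_at (fst p) (snd p)) \<in> borel_measurable (borel \<Otimes>\<^sub>M \<mu>)"
proof -
  let ?g = "\<lambda>p \<epsilon>. (cumul (fst p + \<epsilon>) (snd p) - cumul (fst p - \<epsilon>) (snd p)) / (2 * \<epsilon>)"
  have "(\<lambda>p. real_of_ereal (INF n. SUP \<epsilon>\<in>\<rat> \<inter> {0<..<inverse (real (Suc n))}. ereal (?g p \<epsilon>)))
      \<in> borel_measurable (borel \<Otimes>\<^sub>M \<mu>)"
    by (intro borel_measurable_real_of_ereal borel_measurable_INF borel_measurable_SUP
        borel_measurable_ereal borel_measurable_divide borel_measurable_diff
        borel_measurable_cumul_compose countable_Int1 countable_rat) measurable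
  moreover have "eval_at (fst p) (snd p) =
      real_of_ereal (INF n. SUP \<epsilon>\<in>\<rat> \<inter> {0<..<inverse (real (Suc n))}. ereal (?g p \<epsilon>))"
    if "p \<in> space (borel \<Otimes>\<^sub>M \<mu>)" for p
  proof -
    have r: "snd p \<in> space \<mu>" using that by (auto simp: space_pair_measure)
    have "continuous_on {0<..} (?g p)"
      by (intro continuous_intros continuous_on_compose2[OF continuous_cumul[OF r]]) auto
    then show ?thesis
      unfolding eval_at_eq_Limsup[OF r] by (subst Limsup_at_right_eq_INF_SUP_rats) auto
  qed
  ultimately show ?thesis by (simp cong: measurable_cong)
qed

lemma borel_measurable_eval_at [measurable]: "eval_at x \<in> borel_measurable \<mu>"
  using measurable_compose[OF measurable_Pair1' borel_measurable_eval_at_pair, of x] by simp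

text \<open>The symmetric difference quotient is the mean of the right and the left difference quotient.\<close>

lemma eval_at_eq_derivative:
  assumes r: "r \<in> space \<mu>" and D: "((\<lambda>y. cumul y r) has_real_derivative D) (at x)"
  shows "eval_at x r = D"
proof -
  let ?q = "\<lambda>h. (cumul (x + h) r - cumul x r) / h"
  have q: "(?q \<longlongrightarrow> D) (at 0)" using D by (simp add: DERIV_def)
  have "(?q \<longlongrightarrow> D) (at_right 0)" "(?q \<longlongrightarrow> D) (at_left 0)"
    using q by (simp_all add: filterlim_at_split)
  then have "((\<lambda>h. (?q h + ?q (- h)) / 2) \<longlongrightarrow> (D + D) / 2) (at_right 0)"
    by (intro tendsto_divide tendsto_add tendsto_const) (simp_all add: filterlim_at_left_to_right)
  then have "((\<lambda>h. (?q h + ?q (- h)) / 2) \<longlongrightarrow> D) (at_right 0)" by simp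
  moreover have "\<forall>\<^sub>F h in at_right 0. (?q h + ?q (- h)) / 2 = (cumul (x + h) r - cumul (x - h) r) / (2 * h)"
    using eventually_at_right_less[of 0] by eventually_elim (simp add: field_simps)
  ultimately have "((\<lambda>\<epsilon>. (cumul (x + \<epsilon>) r - cumul (x - \<epsilon>) r) / (2 * \<epsilon>)) \<longlongrightarrow> D) (at_right 0)"
    by (rule Lim_transform_eventually)
  then have "Limsup (at_right 0) (\<lambda>\<epsilon>. ereal ((cumul (x + \<epsilon>) r - cumul (x - \<epsilon>) r) / (2 * \<epsilon>))) = ereal D"
    by (intro lim_imp_Limsup) auto
  then show ?thesis unfolding eval_at_eq_Limsup[OF r] by simp
qed

text \<open>The pairs \<open>(x, r)\<close> for which the primitive of \<open>r\<close> is differentiable at \<open>x\<close>. By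
  \<open>eval_at_eq_derivative\<close>, the only candidate for the derivative is \<open>eval_at x r\<close>; naming it makes the
  set of these pairs visibly measurable.\<close>

abbreviation regular_at :: "real \<Rightarrow> linf \<Rightarrow> bool" where
  "regular_at x r \<equiv> ((\<lambda>y. cumul y r) has_real_derivative eval_at x r) (at x)"

lemma sets_regular_at:
  "{p \<in> space (borel \<Otimes>\<^sub>M \<mu>). regular_at (fst p) (snd p)} \<in> sets (borel \<Otimes>\<^sub>M \<mu>)"
proof -
  have "{p \<in> space (borel \<Otimes>\<^sub>M \<mu>). regular_at (fst p) (snd p)} =
    {p \<in> space (borel \<Otimes>\<^sub>M \<mu>). \<forall>n. \<exists>m. \<forall>h\<in>\<rat>. \<bar>h\<bar> < inverse (real (Suc m)) \<longrightarrow>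
        \<bar>cumul (fst p + h) (snd p) - cumul (fst p) (snd p) - h * eval_at (fst p) (snd p)\<bar>
          \<le> \<bar>h\<bar> * inverse (real (Suc n))}"
    by (intro Collect_cong conj_cong refl has_real_derivative_iff_rats continuous_cumul)
      (auto simp: space_pair_measure)
  also have "\<dots> \<in> sets (borel \<Otimes>\<^sub>M \<mu>)"
  proof -
    note borel_measurable_cumul_compose[measurable]
    show ?thesis
      by (intro sets.sets_Collect_countable_All sets.sets_Collect_countable_Ex
          sets.sets_Collect_countable_All'[OF _ countable_rat] sets.sets_Collect_imp
          sets.sets_Collect_const) measurable
  qed
  finally show ?thesis .
qed

lemma AE_regular_at_of_space:
  assumes r: "r \<in> space \<mu>"
  shows "AE x in lborel. regular_at x r"
proof (rule two_valued_representative[OF r[unfolded space_mu] alpha_pos])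
  fix f assume f: "\<forall>a b. a \<le> b \<longrightarrow> (f has_integral (cumul b r - cumul a r)) {a..b}"
  have "AE x in lebesgue. ((\<lambda>y. cumul y r) has_real_derivative f x) (at x)"
    by (rule AE_has_real_derivative_primitive) (use f in blast)
  then have ae: "AE x in lborel. ((\<lambda>y. cumul y r) has_real_derivative f x) (at x)"
    by (simp only: AE_completion_iff)
  show ?thesis
    using ae by eventually_elim (use eval_at_eq_derivative[OF r] in auto)
qed

lemma AE_AE_regular_at: "AE x in lborel. AE r in \<mu>. regular_at x r"
proof -
  interpret P: pair_sigma_finite lborel \<mu> ..
  have sets_pair: "sets (lborel \<Otimes>\<^sub>M \<mu>) = sets (borel \<Otimes>\<^sub>M \<mu>)"
    by (rule sets_pair_measure_cong) auto
  note space_pair = sets_eq_imp_space_eq[OF sets_pair]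
  have "(AE x in lborel. AE r in \<mu>. regular_at x r) = (AE r in \<mu>. AE x in lborel. regular_at x r)"
    by (rule P.AE_commute) (unfold sets_pair space_pair, rule sets_regular_at)
  then show ?thesis using AE_regular_at_of_space by auto
qed

lemma eval_at_bounds:
  assumes r: "r \<in> space \<mu>" and "0 < x" and reg: "regular_at x r"
  shows "1 \<le> eval_at x r" "eval_at x r \<le> exp \<alpha>"
proof -
  have lim: "((\<lambda>h. (cumul (x + h) r - cumul x r) / h) \<longlongrightarrow> eval_at x r) (at_right 0)"
    using reg by (simp add: DERIV_def filterlim_at_split)
  have ev: "\<forall>\<^sub>F h in at_right (0::real). h > 0" by (rule eventually_at_right_less)
  show "1 \<le> eval_at x r"
    by (rule tendsto_lowerbound[OF lim], use ev in eventually_elim)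
      (use cumul_increment_bounds[OF r, of x "x + _"] \<open>0 < x\<close> in \<open>auto simp: field_simps\<close>)
  show "eval_at x r \<le> exp \<alpha>"
    by (rule tendsto_upperbound[OF lim], use ev in eventually_elim)
      (use cumul_increment_bounds[OF r, of x "x + _"] \<open>0 < x\<close> in \<open>auto simp: field_simps\<close>)
qed

end

section \<open>The public law\<close>

context two_valued_radon_measure
begin

text \<open>The private density averages the evaluation operator to the public density, since \<open>eval_at x r\<close>
  is almost everywhere the value at \<open>x\<close> of a representative of \<open>r\<close>.\<close>

lemma nn_integral_eval_at:
  assumes r: "r \<in> space \<mu>" and "0 < \<theta>"
  shows "(\<integral>\<^sup>+x. ennreal (private_density \<theta> x) * ennreal (eval_at x r) \<partial>lborel) = ennreal (public_density \<theta> r)"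
proof (rule two_valued_representative[OF r[unfolded space_mu] alpha_pos])
  fix f assume f0: "\<forall>x<0. f x = 0" and fK: "\<forall>x\<ge>0. f x \<in> {1..exp \<alpha>}"
    and f: "\<forall>a b. a \<le> b \<longrightarrow> (f has_integral (cumul b r - cumul a r)) {a..b}"
  have nn: "0 \<le> f x" for x using f0[rule_format, of x] fK[rule_format, of x] by (cases "x < 0") auto
  have "AE x in lebesgue. ((\<lambda>y. cumul y r) has_real_derivative f x) (at x)"
    by (rule AE_has_real_derivative_primitive) (use f in blast)
  then have ae: "AE x in lebesgue. f x = \<bar>eval_at x r\<bar>"
  proof eventually_elim
    case (elim x)
    then show ?case using eval_at_eq_derivative[OF r elim] nn[of x] by simp
  qed
  have m: "(\<lambda>x. eval_at x r) \<in> borel_measurable borel"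
    using measurable_compose[OF measurable_Pair2'[OF r] borel_measurable_eval_at_pair] by simp
  have "((\<lambda>x. \<bar>eval_at x r\<bar>) has_integral cumul \<theta> r) {0..\<theta>}"
  proof (subst has_integral_AE)
    show "AE x in lborel. x \<in> {0..\<theta>} \<longrightarrow> \<bar>eval_at x r\<bar> = f x"
      using ae unfolding AE_completion_iff by eventually_elim simp
    show "(f has_integral cumul \<theta> r) {0..\<theta>}"
      using f[rule_format, of 0 \<theta>] \<open>0 < \<theta>\<close> by (simp add: cumul_zero)
  qed
  then have *: "(\<integral>\<^sup>+x. ennreal (indicator {0..\<theta>} x * \<bar>eval_at x r\<bar>) \<partial>lborel) = ennreal (cumul \<theta> r)"
    by (intro nn_integral_has_integral_lebesgue) auto
  have "(\<integral>\<^sup>+x. ennreal (private_density \<theta> x) * ennreal (eval_at x r) \<partial>lborel)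
      = (\<integral>\<^sup>+x. ennreal (1 / \<theta>) * ennreal (indicator {0..\<theta>} x * \<bar>eval_at x r\<bar>) \<partial>lborel)"
  proof (rule nn_integral_cong_AE)
    show "AE x in lborel. ennreal (private_density \<theta> x) * ennreal (eval_at x r)
        = ennreal (1 / \<theta>) * ennreal (indicator {0..\<theta>} x * \<bar>eval_at x r\<bar>)"
      using AE_regular_at_of_space[OF r] AE_lborel_singleton[of 0]
    proof eventually_elim
      case (elim x)
      show ?case
      proof (cases "x \<in> {0..\<theta>}")
        case True
        then have "1 \<le> eval_at x r" using eval_at_bounds[OF r _ elim(1)] elim(2) by simp
        then show ?thesis using True by (simp add: private_density_def)
      qed (simp add: private_density_def)
    qed
  qed
  also have "\<dots> = ennreal (1 / \<theta>) * ennreal (cumul \<theta> r)"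
    using m by (subst nn_integral_cmult) (auto simp: *)
  also have "\<dots> = ennreal (public_density \<theta> r)"
    using \<open>0 < \<theta>\<close> cumul_bounds(1)[OF r, of \<theta>] by (simp add: public_density_eq_cumul ennreal_mult[symmetric])
  finally show ?thesis .
qed

lemma public_density_bounds:
  assumes "r \<in> space \<mu>" "0 < \<theta>"
  shows "1 \<le> public_density \<theta> r" "public_density \<theta> r \<le> exp \<alpha>"
  using cumul_bounds[OF assms(1), of \<theta>] assms(2)
  by (auto simp: public_density_eq_cumul field_simps)

lemma borel_measurable_public_density [measurable]: "public_density \<theta> \<in> borel_measurable \<mu>"
  unfolding public_density_eq_cumul[abs_def] by measurable

lemma emeasure_public_law:
  assumes "0 < \<theta>" and A [measurable]: "A \<in> sets \<mu>"
  shows "emeasure (public_law \<mu> \<theta>) A = (\<integral>\<^sup>+x. emeasure (mechanism \<mu> x) A \<partial>private_law \<theta>)"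
proof -
  interpret P: pair_sigma_finite lborel \<mu> ..
  have sets_pair: "sets (lborel \<Otimes>\<^sub>M \<mu>) = sets (borel \<Otimes>\<^sub>M \<mu>)"
    by (rule sets_pair_measure_cong) auto
  have em: "(\<lambda>p. eval_at (fst p) (snd p)) \<in> borel_measurable (lborel \<Otimes>\<^sub>M \<mu>)"
    using borel_measurable_eval_at_pair by (simp cong: measurable_cong_sets add: sets_pair)
  have pm [measurable]: "private_density \<theta> \<in> borel_measurable borel"
    unfolding private_density_def by measurable
  have mech: "emeasure (mechanism \<mu> x) A = (\<integral>\<^sup>+r. ennreal (eval_at x r) * indicator A r \<partial>\<mu>)" for x
    unfolding mechanism_def by (rule emeasure_density) measurable
  have m1: "(\<lambda>p. ennreal (eval_at (fst p) (snd p)) * indicator A (snd p)) \<in> borel_measurable (lborel \<Otimes>\<^sub>M \<mu>)"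
    by (intro borel_measurable_times_ennreal measurable_compose[OF em measurable_ennreal]) measurable
  have m2: "(\<lambda>x. emeasure (mechanism \<mu> x) A) \<in> borel_measurable lborel"
    unfolding mech using borel_measurable_nn_integral[of "\<lambda>x r. ennreal (eval_at x r) * indicator A r" lborel] m1
    by (simp add: case_prod_beta')
  have em_r: "(\<lambda>x. eval_at x r) \<in> borel_measurable borel" if r: "r \<in> space \<mu>" for r
    using measurable_compose[OF measurable_Pair2'[OF r] borel_measurable_eval_at_pair] by simp
  let ?p = "\<lambda>x. ennreal (private_density \<theta> x)"
  have "emeasure (public_law \<mu> \<theta>) A = (\<integral>\<^sup>+r. ennreal (public_density \<theta> r) * indicator A r \<partial>\<mu>)"
    unfolding public_law_def by (rule emeasure_density) measurable
  also have "\<dots> = (\<integral>\<^sup>+r. (\<integral>\<^sup>+x. ?p x * (ennreal (eval_at x r) * indicator A r) \<partial>lborel) \<partial>\<mu>)"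
  proof (rule nn_integral_cong)
    fix r assume r: "r \<in> space \<mu>"
    have [measurable]: "(\<lambda>x. eval_at x r) \<in> borel_measurable borel" by (rule em_r[OF r])
    show "ennreal (public_density \<theta> r) * indicator A r = (\<integral>\<^sup>+x. ?p x * (ennreal (eval_at x r) * indicator A r) \<partial>lborel)"
      unfolding nn_integral_eval_at[OF r \<open>0 < \<theta>\<close>, symmetric] mult.assoc[symmetric]
      by (rule nn_integral_multc[symmetric]) measurable
  qed
  also have "\<dots> = (\<integral>\<^sup>+x. (\<integral>\<^sup>+r. ?p x * (ennreal (eval_at x r) * indicator A r) \<partial>\<mu>) \<partial>lborel)"
  proof (rule P.Fubini')
    have "(\<lambda>p. ?p (fst p) * (ennreal (eval_at (fst p) (snd p)) * indicator A (snd p))) \<in> borel_measurable (lborel \<Otimes>\<^sub>M \<mu>)"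
      by (rule borel_measurable_times_ennreal[OF _ m1]) measurable
    then show "(\<lambda>(x, r). ?p x * (ennreal (eval_at x r) * indicator A r)) \<in> borel_measurable (lborel \<Otimes>\<^sub>M \<mu>)"
      by (simp add: case_prod_beta')
  qed
  also have "\<dots> = (\<integral>\<^sup>+x. ?p x * emeasure (mechanism \<mu> x) A \<partial>lborel)"
    unfolding mech by (intro nn_integral_cong nn_integral_cmult) measurable
  also have "\<dots> = (\<integral>\<^sup>+x. emeasure (mechanism \<mu> x) A \<partial>private_law \<theta>)"
    unfolding private_law_def using m2 by (intro nn_integral_density[symmetric]) auto
  finally show ?thesis .
qed

lemma prob_space_public_law:
  assumes mean: "AE x in lebesgue_on {0..}. (LINT r|\<mu>. eval_at x r) = 1" and "0 < \<theta>"
  shows "prob_space (public_law \<mu> \<theta>)"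
proof (rule prob_spaceI)
  have mean': "AE x in lborel. 0 \<le> x \<longrightarrow> (LINT r|\<mu>. eval_at x r) = 1"
    using mean by (simp add: AE_restrict_space_iff AE_completion_iff)
  have "emeasure (public_law \<mu> \<theta>) (space (public_law \<mu> \<theta>)) = emeasure (public_law \<mu> \<theta>) (space \<mu>)"
    by (simp add: public_law_def)
  also have "\<dots> = (\<integral>\<^sup>+x. emeasure (mechanism \<mu> x) (space \<mu>) \<partial>private_law \<theta>)"
    by (rule emeasure_public_law[OF \<open>0 < \<theta>\<close>]) simp
  also have "\<dots> = (\<integral>\<^sup>+x. 1 \<partial>private_law \<theta>)"
  proof (rule nn_integral_cong_AE)
    show "AE x in private_law \<theta>. emeasure (mechanism \<mu> x) (space \<mu>) = 1"
    proof -
      have "AE x in lborel. 0 < ennreal (private_density \<theta> x) \<longrightarrow> emeasure (mechanism \<mu> x) (space \<mu>) = 1"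
        using mean' AE_AE_regular_at AE_lborel_singleton[of 0]
      proof eventually_elim
        case (elim x)
        show ?case
        proof
          assume "0 < ennreal (private_density \<theta> x)"
          then have "x \<in> {0..\<theta>}"
            by (rule contrapos_pp) (simp add: private_density_def)
          then have "0 < x" using elim(3) by simp
          have nn: "AE r in \<mu>. 0 \<le> eval_at x r"
            using elim(2) AE_space
          proof eventually_elim
            case (elim r)
            then show ?case using eval_at_bounds(1)[OF elim(2) \<open>0 < x\<close> elim(1)] by simp
          qed
          have one: "(LINT r|\<mu>. eval_at x r) = 1" using elim(1) \<open>0 < x\<close> by simp
          \<comment> \<open>A Bochner integral different from \<open>0\<close> entails integrability.\<close>
          then have int: "integrable \<mu> (eval_at x)"
            using not_integrable_integral_eq by fastforce
          have "emeasure (mechanism \<mu> x) (space \<mu>) = (\<integral>\<^sup>+r. ennreal (eval_at x r) * indicator (space \<mu>) r \<partial>\<mu>)"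
            unfolding mechanism_def by (rule emeasure_density) measurable
          also have "\<dots> = (\<integral>\<^sup>+r. ennreal (eval_at x r) \<partial>\<mu>)" by (rule nn_integral_cong) simp
          also have "\<dots> = 1" using nn_integral_eq_integral[OF int nn] one by simp
          finally show "emeasure (mechanism \<mu> x) (space \<mu>) = 1" .
        qed
      qed
      then show ?thesis unfolding private_law_def
        by (subst AE_density) (auto simp: private_density_def)
    qed
  qed
  also have "\<dots> = (\<integral>\<^sup>+x. ennreal (1 / \<theta>) * indicator {0..\<theta>} x \<partial>lborel)"
    unfolding private_law_def
    by (subst nn_integral_density)
      (auto simp: private_density_def indicator_def intro!: nn_integral_cong)
  also have "\<dots> = 1"
    using \<open>0 < \<theta>\<close> by (simp add: nn_integral_cmult ennreal_mult[symmetric])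
  finally show "emeasure (public_law \<mu> \<theta>) (space (public_law \<mu> \<theta>)) = 1" .
qed

end

section \<open>Score and Fisher information\<close>

context two_valued_radon_measure
begin

lemma public_density_lipschitz:
  assumes r: "r \<in> space \<mu>" and "0 < \<theta>\<^sub>0" and h: "\<bar>h\<bar> < \<theta>\<^sub>0 / 2"
  shows "\<bar>public_density (\<theta>\<^sub>0 + h) r - public_density \<theta>\<^sub>0 r\<bar> \<le> 4 * exp \<alpha> / \<theta>\<^sub>0 * \<bar>h\<bar>"
proof -
  let ?F = "\<lambda>x. cumul x r" and ?\<theta> = "\<theta>\<^sub>0 + h"
  have \<theta>: "\<theta>\<^sub>0 / 2 \<le> ?\<theta>" "0 < ?\<theta>" using h \<open>0 < \<theta>\<^sub>0\<close> by linarith+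
  have "public_density ?\<theta> r - public_density \<theta>\<^sub>0 r = ((?F ?\<theta> - ?F \<theta>\<^sub>0) - h * public_density \<theta>\<^sub>0 r) / ?\<theta>"
    using \<theta> \<open>0 < \<theta>\<^sub>0\<close> by (simp add: public_density_eq_cumul field_simps)
  then have "\<bar>public_density ?\<theta> r - public_density \<theta>\<^sub>0 r\<bar> = \<bar>(?F ?\<theta> - ?F \<theta>\<^sub>0) - h * public_density \<theta>\<^sub>0 r\<bar> / ?\<theta>"
    using \<theta> by simp
  also have "\<dots> \<le> (2 * exp \<alpha> * \<bar>h\<bar>) / ?\<theta>"
  proof (rule divide_right_mono)
    have "\<bar>h * public_density \<theta>\<^sub>0 r\<bar> \<le> \<bar>h\<bar> * exp \<alpha>"
      using public_density_bounds[OF r \<open>0 < \<theta>\<^sub>0\<close>] by (auto simp: abs_mult intro!: mult_left_mono)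
    moreover have "\<bar>?F ?\<theta> - ?F \<theta>\<^sub>0\<bar> \<le> exp \<alpha> * \<bar>h\<bar>"
      using cumul_lipschitz[OF r, of ?\<theta> \<theta>\<^sub>0] by simp
    ultimately show "\<bar>(?F ?\<theta> - ?F \<theta>\<^sub>0) - h * public_density \<theta>\<^sub>0 r\<bar> \<le> 2 * exp \<alpha> * \<bar>h\<bar>"
      by (simp add: mult.commute)
  qed (use \<theta> in simp)
  also have "\<dots> \<le> (2 * exp \<alpha> * \<bar>h\<bar>) / (\<theta>\<^sub>0 / 2)"
    using \<theta> \<open>0 < \<theta>\<^sub>0\<close> by (intro divide_left_mono) auto
  also have "\<dots> = 4 * exp \<alpha> / \<theta>\<^sub>0 * \<bar>h\<bar>" by simp
  finally show ?thesis .
qed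

text \<open>The derivative of the logarithm of \<open>cumul \<theta> r / \<theta>\<close>, with \<open>eval_at \<theta> r\<close> for the derivative
  of \<open>cumul\<close>.\<close>

definition public_score :: "real \<Rightarrow> linf \<Rightarrow> real" where
  "public_score \<theta> r = (eval_at \<theta> r - public_density \<theta> r) / (\<theta> * public_density \<theta> r)"

lemma dqm_score_public_score:
  assumes "0 < \<theta>\<^sub>0" and reg: "AE r in \<mu>. regular_at \<theta>\<^sub>0 r"
  shows "dqm_score \<mu> {0<..} public_density \<theta>\<^sub>0 (public_score \<theta>\<^sub>0)"
proof -
  define g where "g \<theta> r = sqrt (public_density \<theta> r)" for \<theta> r
  define D where "D r = 1/2 * public_score \<theta>\<^sub>0 r * sqrt (public_density \<theta>\<^sub>0 r)" for r
  have tm [measurable]: "public_score \<theta>\<^sub>0 \<in> borel_measurable \<mu>"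
    unfolding public_score_def by measurable
  have gm: "g \<theta> \<in> borel_measurable \<mu>" for \<theta> unfolding g_def by measurable
  have Dm: "D \<in> borel_measurable \<mu>" unfolding D_def by measurable
  have lip: "\<bar>g (\<theta>\<^sub>0 + h) r - g \<theta>\<^sub>0 r\<bar> \<le> 4 * exp \<alpha> / \<theta>\<^sub>0 * \<bar>h\<bar>"
    if "\<bar>h\<bar> < \<theta>\<^sub>0 / 2" "r \<in> space \<mu>" for h r
  proof -
    have "0 < \<theta>\<^sub>0 + h" using that \<open>0 < \<theta>\<^sub>0\<close> by linarith
    then show ?thesis
      using abs_sqrt_diff_le[OF public_density_bounds(1) public_density_bounds(1), of r "\<theta>\<^sub>0 + h" r \<theta>\<^sub>0]
        public_density_lipschitz[OF that(2) \<open>0 < \<theta>\<^sub>0\<close> that(1)] that \<open>0 < \<theta>\<^sub>0\<close>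
      unfolding g_def by linarith
  qed
  have deriv: "AE r in \<mu>. ((\<lambda>\<theta>. g \<theta> r) has_real_derivative D r) (at \<theta>\<^sub>0)"
    using reg AE_space
  proof eventually_elim
    case (elim r)
    let ?f = "public_density \<theta>\<^sub>0 r"
    have f: "?f \<ge> 1" by (rule public_density_bounds(1)[OF elim(2) \<open>0 < \<theta>\<^sub>0\<close>])
    have F: "cumul \<theta>\<^sub>0 r = \<theta>\<^sub>0 * ?f" using \<open>0 < \<theta>\<^sub>0\<close> by (simp add: public_density_eq_cumul)
    have "((\<lambda>\<theta>. cumul \<theta> r / \<theta>) has_real_derivative (eval_at \<theta>\<^sub>0 r * \<theta>\<^sub>0 - cumul \<theta>\<^sub>0 r * 1) / (\<theta>\<^sub>0 * \<theta>\<^sub>0)) (at \<theta>\<^sub>0)"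
      by (rule DERIV_divide[OF elim(1) DERIV_ident]) (use \<open>0 < \<theta>\<^sub>0\<close> in simp)
    then have "((\<lambda>\<theta>. public_density \<theta> r) has_real_derivative (eval_at \<theta>\<^sub>0 r - ?f) / \<theta>\<^sub>0) (at \<theta>\<^sub>0)"
      unfolding F public_density_eq_cumul[symmetric]
      by (rule DERIV_cong) (use \<open>0 < \<theta>\<^sub>0\<close> in \<open>simp add: field_simps\<close>)
    then have "((\<lambda>\<theta>. sqrt (public_density \<theta> r)) has_real_derivative
        inverse (sqrt ?f) / 2 * ((eval_at \<theta>\<^sub>0 r - ?f) / \<theta>\<^sub>0)) (at \<theta>\<^sub>0)"
      by (rule DERIV_chain2[rotated]) (use f in \<open>auto intro!: DERIV_real_sqrt\<close>)
    then show ?case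
      unfolding g_def
    proof (rule DERIV_cong)
      have "sqrt ?f / ?f = inverse (sqrt ?f)" using f by (intro sqrt_divide_self_eq) simp
      moreover have "D r = (eval_at \<theta>\<^sub>0 r - ?f) / \<theta>\<^sub>0 / 2 * (sqrt ?f / ?f)"
        by (simp add: D_def public_score_def)
      ultimately show "inverse (sqrt ?f) / 2 * ((eval_at \<theta>\<^sub>0 r - ?f) / \<theta>\<^sub>0) = D r"
        by (simp add: mult.commute)
    qed
  qed
  have pos: "\<theta>\<^sub>0 / 2 > 0" using \<open>0 < \<theta>\<^sub>0\<close> by simp
  have form: "sqrt (public_density (\<theta>\<^sub>0 + h) r) - sqrt (public_density \<theta>\<^sub>0 r) -
      1/2 * h * public_score \<theta>\<^sub>0 r * sqrt (public_density \<theta>\<^sub>0 r) = g (\<theta>\<^sub>0 + h) r - g \<theta>\<^sub>0 r - h * D r" for h r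
    by (simp add: g_def D_def)
  show ?thesis
    unfolding dqm_score_def form
    using quadratic_mean_derivative[OF finite_measure_axioms gm Dm pos lip deriv] \<open>0 < \<theta>\<^sub>0\<close> tm
    by (simp add: interior_open)
qed

lemma fisher_information_public_score:
  assumes "0 < \<theta>\<^sub>0" and reg: "AE r in \<mu>. regular_at \<theta>\<^sub>0 r"
  shows "fisher_information \<mu> public_density \<theta>\<^sub>0 (public_score \<theta>\<^sub>0) \<le> ennreal ((exp \<alpha> - 1)\<^sup>2 / \<theta>\<^sub>0\<^sup>2)"
proof -
  let ?c = "(exp \<alpha> - 1)\<^sup>2 / \<theta>\<^sub>0\<^sup>2"
  have "AE r in \<mu>. (public_score \<theta>\<^sub>0 r)\<^sup>2 * public_density \<theta>\<^sub>0 r \<le> ?c"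
    using reg AE_space
  proof eventually_elim
    case (elim r)
    let ?f = "public_density \<theta>\<^sub>0 r" and ?e = "eval_at \<theta>\<^sub>0 r"
    note f = public_density_bounds[OF elim(2) \<open>0 < \<theta>\<^sub>0\<close>]
      and e = eval_at_bounds[OF elim(2) \<open>0 < \<theta>\<^sub>0\<close> elim(1)]
    have "(public_score \<theta>\<^sub>0 r)\<^sup>2 * ?f = (?e - ?f)\<^sup>2 / \<theta>\<^sub>0\<^sup>2 / ?f"
      using f by (simp add: public_score_def power_divide power_mult_distrib power2_eq_square)
    also have "\<dots> \<le> (?e - ?f)\<^sup>2 / \<theta>\<^sub>0\<^sup>2 / 1"
      using f by (intro divide_left_mono) auto
    also have "\<dots> \<le> ?c"
    proof -
      have "\<bar>?e - ?f\<bar> \<le> \<bar>exp \<alpha> - 1\<bar>" using f e by linarith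
      then have "(?e - ?f)\<^sup>2 \<le> (exp \<alpha> - 1)\<^sup>2" by (rule abs_le_square_iff[THEN iffD1])
      then show ?thesis by (simp add: divide_right_mono)
    qed
    finally show ?case .
  qed
  then have "fisher_information \<mu> public_density \<theta>\<^sub>0 (public_score \<theta>\<^sub>0) \<le> (\<integral>\<^sup>+r. ennreal ?c \<partial>\<mu>)"
    unfolding fisher_information_def
    by (intro nn_integral_mono_AE) (auto elim!: eventually_mono intro!: ennreal_leI)
  also have "\<dots> = ennreal ?c * emeasure \<mu> (space \<mu>)" by simp
  also have "\<dots> \<le> ennreal ?c * 1" by (intro mult_left_mono emeasure_space_le_1) auto
  finally show ?thesis by simp
qed

end

theorem proposition3:
  fixes \<alpha> :: real and \<mu> :: "linf measure"
  assumes "\<alpha> > 0"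
    and "radon_subprob_on (two_valued_set \<alpha>) \<mu>"
    and "AE x in lebesgue_on {0..}. (LINT r|\<mu>. eval_at x r) = 1"
  shows "has_densities \<mu> {0<..} (public_law \<mu>) public_density \<and>
    (\<forall>\<theta>>0. \<forall>A\<in>sets \<mu>.
      emeasure (public_law \<mu> \<theta>) A = (\<integral>\<^sup>+x. emeasure (mechanism \<mu> x) A \<partial>private_law \<theta>)) \<and>
    (AE \<theta>\<^sub>0 in lebesgue_on {0<..}.
      dqm_at \<mu> {0<..} public_density \<theta>\<^sub>0 \<and>
      (\<forall>t. dqm_score \<mu> {0<..} public_density \<theta>\<^sub>0 t \<longrightarrow>
        fisher_information \<mu> public_density \<theta>\<^sub>0 t \<le> ennreal ((exp \<alpha> - 1)\<^sup>2 / \<theta>\<^sub>0\<^sup>2)))"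
proof -
  interpret two_valued_radon_measure \<alpha> \<mu>
    using assms(1,2) by unfold_locales
  have nonneg: "0 \<le> public_density \<theta> r" if "r \<in> space \<mu>" "0 < \<theta>" for \<theta> r
    using public_density_bounds(1)[OF that] by linarith
  have "has_densities \<mu> {0<..} (public_law \<mu>) public_density"
    unfolding has_densities_def
    using prob_space_public_law[OF assms(3)] nonneg borel_measurable_public_density
    by (auto simp: public_law_def)
  moreover have "AE \<theta>\<^sub>0 in lebesgue_on {0<..}.
      dqm_at \<mu> {0<..} public_density \<theta>\<^sub>0 \<and>
      (\<forall>t. dqm_score \<mu> {0<..} public_density \<theta>\<^sub>0 t \<longrightarrow>
        fisher_information \<mu> public_density \<theta>\<^sub>0 t \<le> ennreal ((exp \<alpha> - 1)\<^sup>2 / \<theta>\<^sub>0\<^sup>2))"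
  proof -
    have "AE \<theta>\<^sub>0 in lebesgue. AE r in \<mu>. regular_at \<theta>\<^sub>0 r"
      using AE_AE_regular_at by (simp only: AE_completion_iff)
    then have "AE \<theta>\<^sub>0 in lebesgue. \<theta>\<^sub>0 \<in> {0<..} \<longrightarrow> (dqm_at \<mu> {0<..} public_density \<theta>\<^sub>0 \<and>
      (\<forall>t. dqm_score \<mu> {0<..} public_density \<theta>\<^sub>0 t \<longrightarrow>
        fisher_information \<mu> public_density \<theta>\<^sub>0 t \<le> ennreal ((exp \<alpha> - 1)\<^sup>2 / \<theta>\<^sub>0\<^sup>2)))"
    proof eventually_elim
      case (elim \<theta>\<^sub>0)
      show ?case
      proof
        assume "\<theta>\<^sub>0 \<in> {0<..}"
        then have pos: "0 < \<theta>\<^sub>0" by simp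
        note score = dqm_score_public_score[OF pos elim]
        have "fisher_information \<mu> public_density \<theta>\<^sub>0 t \<le> ennreal ((exp \<alpha> - 1)\<^sup>2 / \<theta>\<^sub>0\<^sup>2)"
          if "dqm_score \<mu> {0<..} public_density \<theta>\<^sub>0 t" for t
          using fisher_information_cong_score[OF that score borel_measurable_public_density nonneg[OF _ pos]]
            fisher_information_public_score[OF pos elim] by simp
        then show "dqm_at \<mu> {0<..} public_density \<theta>\<^sub>0 \<and>
          (\<forall>t. dqm_score \<mu> {0<..} public_density \<theta>\<^sub>0 t \<longrightarrow>
            fisher_information \<mu> public_density \<theta>\<^sub>0 t \<le> ennreal ((exp \<alpha> - 1)\<^sup>2 / \<theta>\<^sub>0\<^sup>2))"
          using score by (auto simp: dqm_at_def)
      qed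
    qed
    then show ?thesis by (subst AE_restrict_space_iff) auto
  qed
  ultimately show ?thesis using emeasure_public_law by blast
qed

end
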